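(* Let $K\subseteq\mathbb C$ be compact and $\varphi\in A(K)$. The following assertions are equivalent: (1) $\varphi$ is a generator for $A(K)$; that is, $A(K)=[\varphi]_{\rm alg}$; (2) $\varphi$ is a homeomorphism of $K$ onto $\varphi(K)$ and $\mathbb C\setminus K$ is connected.
   Context: $A(K)$ is the algebra of all complex-valued continuous functions on $K$ that are holomorphic in the interior $K^\circ$ of $K$, with the supremum norm. $[\varphi]_{\rm alg}$ denotes the closed subalgebra generated by $\varphi$, i.e. the uniform closure on $K$ of $\{p\circ\varphi: p\in\mathbb C[z]\}$ (constants included). *)

theory Defs
  imports "HOL-Complex_Analysis.Complex_Analysis" "HOL-Computational_Algebra.Polynomial"
begin

text \<open>
  A function on \<open>K\<close> is represented by a total function \<open>complex \<Rightarrow> complex\<close> whose values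
  outside \<open>K\<close> are irrelevant. Both sets below are invariant under changing functions
  outside \<open>K\<close> (see the two congruence lemmas), so equality of such sets
  is equality of the corresponding sets of functions on \<open>K\<close>.
\<close>

definition A_algebra :: "complex set \<Rightarrow> (complex \<Rightarrow> complex) set" where
  "A_algebra K = {f. continuous_on K f \<and> f holomorphic_on interior K}"

definition generated_closed_subalgebra ::
  "complex set \<Rightarrow> (complex \<Rightarrow> complex) \<Rightarrow> (complex \<Rightarrow> complex) set" where
  "generated_closed_subalgebra K \<phi> =
     {f. \<exists>p :: nat \<Rightarrow> complex poly. uniform_limit K (\<lambda>n z. poly (p n) (\<phi> z)) f sequentially}"

definition is_generator :: "complex set \<Rightarrow> (complex \<Rightarrow> complex) \<Rightarrow> bool" where
  "is_generator K \<phi> \<longleftrightarrow> A_algebra K = generated_closed_subalgebra K \<phi>"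

lemma A_algebra_cong:
  assumes "\<And>z. z \<in> K \<Longrightarrow> f z = g z"
  shows "f \<in> A_algebra K \<longleftrightarrow> g \<in> A_algebra K"
proof -
  have "continuous_on K f \<longleftrightarrow> continuous_on K g"
    using assms by (intro continuous_on_cong) auto
  moreover have "f holomorphic_on interior K \<longleftrightarrow> g holomorphic_on interior K"
    using assms interior_subset by (intro holomorphic_cong) auto
  ultimately show ?thesis
    by (simp add: A_algebra_def)
qed

lemma generated_closed_subalgebra_cong:
  assumes "\<And>z. z \<in> K \<Longrightarrow> f z = g z" and "\<And>z. z \<in> K \<Longrightarrow> \<phi> z = \<psi> z"
  shows "f \<in> generated_closed_subalgebra K \<phi> \<longleftrightarrow> g \<in> generated_closed_subalgebra K \<psi>"
proof -
  have "uniform_limit K (\<lambda>n z. poly (p n) (\<phi> z)) f sequentially \<longleftrightarrow>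
        uniform_limit K (\<lambda>n z. poly (p n) (\<psi> z)) g sequentially" for p :: "nat \<Rightarrow> complex poly"
    using assms by (intro uniform_limit_cong') auto
  then show ?thesis
    by (simp add: generated_closed_subalgebra_def)
qed

end

theory Submission
  imports Defs
begin

text \<open>
  The heart of the matter is Mergelyan's theorem. Its only ingredient that is usually taken from
  the theory of univalent functions is a bounded function on the complement of a continuum \<open>E\<close>
  with large derivative at infinity. For an arc \<open>E\<close> from \<open>a\<close> to \<open>q\<close> there is an elementary one:
  a branch \<open>s\<close> of the square root of \<open>(z - a) / (z - q)\<close> with \<open>s(\<infinity>) = 1\<close> takes all values near \<open>1\<close>
  close to infinity, and it never takes both a value and its negative, so \<open>s\<close> stays away from
  \<open>- 1\<close> and \<open>1 / (s + 1) - 1 / 2\<close> is bounded. From it one builds functions that are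
  holomorphic off \<open>E\<close> and imitate the Cauchy kernel to third order at infinity.

  Extend \<open>f\<close> continuously to the plane with compact support. The average of \<open>f\<close> over a square of
  half side \<open>h\<close> centred at \<open>z\<close> is, up to a constant factor, the Cauchy transform of the density whose
  value at \<open>\<zeta>\<close> is the contour integral of \<open>f\<close> around the square centred at \<open>\<zeta>\<close> (by Fubini and the
  winding number of a rectangle). The density is bounded by the modulus of continuity and
  vanishes unless its square meets the complement of the interior of \<open>K\<close>. Close to such a
  point there is an arc outside \<open>K\<close>, and the imitated kernels may replace the Cauchy kernel, cell
  by cell of a grid.

  If \<open>\<phi>\<close> is a homeomorphism and \<open>K\<close> does not separate the plane, then neither does \<open>\<phi>(K)\<close>, and
  Mergelyan's theorem on \<open>\<phi>(K)\<close> approximates \<open>f \<circ> \<phi>\<^sup>-\<^sup>1\<close>. Conversely, a generator separates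
  points, and if \<open>b\<close> lay in a bounded component of the complement of \<open>\<phi>(K)\<close>, then polynomials
  would approximate \<open>1 / (w - b)\<close> on \<open>\<phi>(K)\<close>, against the maximum principle.
\<close>

subsection \<open>The area integral of a decaying kernel\<close>

text \<open>The substitution x = r t^2 turns the integrand into 2 / (1 + t^2); in the old variable
  the antiderivative is \<open>?F\<close>, which rises from 0 to pi.\<close>

lemma nn_integral_half_line_kernel:
  fixes r :: real assumes r: "r > 0"
  shows "(\<integral>\<^sup>+x. ennreal (sqrt r / (sqrt \<bar>x\<bar> * (r + \<bar>x\<bar>))) * indicator {0<..} x \<partial>lborel) = ennreal pi"
proof -
  let ?f = "\<lambda>x. sqrt r / (sqrt x * (r + x))" and ?F = "\<lambda>x. 2 * arctan (sqrt (x / r))"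
  have d: "DERIV ?F x :> ?f x" if "ereal 0 < ereal x" for x
  proof -
    have x: "x > 0" using that by simp
    have e: "2 * (inverse (1 + x / r) * (inverse (sqrt (x/r)) / 2 * (1 / r))) = ?f x"
    proof -
      have "sqrt r * sqrt r = r" using r by simp
      moreover have "sqrt x > 0" "sqrt r > 0" using x r by auto
      ultimately show ?thesis using x r by (simp add: divide_simps real_sqrt_divide) 
    qed
    have "DERIV ?F x :> 2 * (inverse (1 + x / r) * (inverse (sqrt (x/r)) / 2 * (1 / r)))"
      using x r by (auto intro!: derivative_eq_intros simp: field_simps)
    then show ?thesis using e by simp
  qed
  have c: "isCont ?f x" if "ereal 0 < ereal x" for x
    using that r by (auto intro!: continuous_intros)
  have A: "((?F \<circ> real_of_ereal) \<longlongrightarrow> 0) (at_right (ereal 0))"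
  proof -
    have "(?F \<longlongrightarrow> ?F 0) (at_right 0)"
      using r by (intro tendsto_intros continuous_within_tendsto_compose | simp)+
    then show ?thesis by (intro ereal_tendsto_simps(2)[THEN iffD2]) simp
  qed
  have B: "((?F \<circ> real_of_ereal) \<longlongrightarrow> pi) (at_left \<infinity>)"
  proof -
    have "LIM x at_top. sqrt (x / r) :> at_top"
      using filterlim_compose[OF sqrt_at_top filterlim_tendsto_pos_mult_at_top[OF tendsto_const, of "1 / r"  "\<lambda>x. x"]] r by (simp add: filterlim_ident)
    then have "((\<lambda>x. arctan (sqrt (x/r))) \<longlongrightarrow> pi/2) at_top"
      by (rule filterlim_compose[OF tendsto_arctan_at_top])
    then have "(?F \<longlongrightarrow> 2 * (pi/2)) at_top" by (intro tendsto_intros)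
    then show ?thesis by (simp add: ereal_tendsto_simps)
  qed
  have n: "AE x in lborel. ereal 0 < ereal x \<longrightarrow> ereal x < \<infinity> \<longrightarrow> 0 \<le> ?f x" using r by auto
  have I: "set_integrable lborel (einterval 0 \<infinity>) ?f" "(LBINT x=0..\<infinity>. ?f x) = pi - 0"
    using interval_integral_FTC_nonneg[OF _ d c n A B] by (auto simp: zero_ereal_def)
  have "ennreal (LINT x:{0<..}|lborel. ?f x) = (\<integral>\<^sup>+x. ennreal (indicator {0<..} x * ?f x) \<partial>lborel)"
    unfolding set_lebesgue_integral_def using I r
    by (subst nn_integral_eq_integral) (auto simp: set_integrable_def einterval_def greaterThan_def indicator_def zero_ereal_def)
  also have "\<dots> = (\<integral>\<^sup>+x. ennreal (sqrt r / (sqrt \<bar>x\<bar> * (r + \<bar>x\<bar>))) * indicator {0<..} x \<partial>lborel)"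
    by (intro nn_integral_cong) (auto simp: indicator_def)
  finally show ?thesis
    using I(2) by (simp add: interval_lebesgue_integral_def einterval_def greaterThan_def zero_ereal_def)
qed

lemma nn_integral_line_kernel:
  fixes r :: real assumes r: "r > 0"
  shows "(\<integral>\<^sup>+x. ennreal (sqrt r / (sqrt \<bar>x\<bar> * (r + \<bar>x\<bar>))) \<partial>lborel) = ennreal (2 * pi)"
proof -
  let ?g = "\<lambda>x. ennreal (sqrt r / (sqrt \<bar>x\<bar> * (r + \<bar>x\<bar>)))"
  have "(\<integral>\<^sup>+x. ?g x \<partial>lborel) = (\<integral>\<^sup>+x. ?g x * indicator {0<..} x + ?g x * indicator {..<0} x \<partial>lborel)"
    by (intro nn_integral_cong) (auto simp: indicator_def)
  also have "\<dots> = (\<integral>\<^sup>+x. ?g x * indicator {0<..} x \<partial>lborel) + (\<integral>\<^sup>+x. ?g x * indicator {..<0} x \<partial>lborel)"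
    by (intro nn_integral_add) auto
  also have "(\<integral>\<^sup>+x. ?g x * indicator {..<0} x \<partial>lborel) = (\<integral>\<^sup>+x. ?g (0 + (-1) * x) * indicator {..<0} (0 + (-1) * x) \<partial>lborel)"
    by (subst nn_integral_real_affine[where c = "-1" and t = 0]) auto
  also have "\<dots> = (\<integral>\<^sup>+x. ?g x * indicator {0<..} x \<partial>lborel)"
    by (intro nn_integral_cong) (auto simp: indicator_def)
  finally show ?thesis
    using nn_integral_half_line_kernel[OF r] by (simp flip: ennreal_plus)
qed

text \<open>Up to a factor 2 this is 1 / |z| for |z| \<le> r and r^2 / |z|^3 for |z| \<ge> r: the
  singularity of the Cauchy kernel near 0 and third-order decay at infinity, hence integrable over
  the plane.\<close>

definition decay_kernel :: "real \<Rightarrow> complex \<Rightarrow> real" where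
  "decay_kernel r z = r\<^sup>2 / (norm z * (r\<^sup>2 + (norm z)\<^sup>2))"

lemma decay_kernel_nonneg: "0 \<le> decay_kernel r z" unfolding decay_kernel_def by (intro divide_nonneg_nonneg) auto

lemma decay_kernel_borel [measurable]: "decay_kernel r \<in> borel_measurable borel"
  unfolding decay_kernel_def by measurable

lemma AE_lborel_coordinate_neq:
  fixes b :: "'a::euclidean_space" assumes "b \<in> Basis"
  shows "AE x in lborel. x \<bullet> b \<noteq> c"
proof -
  have "negligible {x. x \<bullet> b = c}" using negligible_standard_hyperplane[OF assms] .
  then have "{x. x \<bullet> b = c} \<in> null_sets lebesgue" by (simp add: negligible_iff_null_sets)
  then have "AE x in lebesgue. x \<bullet> b \<noteq> c" by (auto dest: AE_not_in)
  then show ?thesis by (simp add: AE_completion_iff)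
qed

text \<open>Domination by a product of one-variable functions reduces the area integral to Tonelli,
  without polar coordinates. With x = |Re z| and y = |Im z| the two ingredients are x y \<le> |z|^2
  and (r + x) (r + y) \<le> 2 (r^2 + |z|^2).\<close>

lemma decay_kernel_le_product:
  assumes r: "r > 0" and z: "Re z \<noteq> 0" "Im z \<noteq> 0"
  shows "decay_kernel r z \<le> 2 * r * ((sqrt r / (sqrt \<bar>Re z\<bar> * (r + \<bar>Re z\<bar>))) * (sqrt r / (sqrt \<bar>Im z\<bar> * (r + \<bar>Im z\<bar>))))"
proof -
  define x y where "x = \<bar>Re z\<bar>" and "y = \<bar>Im z\<bar>"
  have xy: "x > 0" "y > 0" using z by (auto simp: x_def y_def)
  have nz: "(norm z)\<^sup>2 = x\<^sup>2 + y\<^sup>2" by (simp add: cmod_power2 x_def y_def)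
  have "sqrt x * sqrt y \<le> norm z"
  proof (rule power2_le_imp_le)
    have "x * y \<le> x\<^sup>2 + y\<^sup>2" using xy sum_squares_bound[of x y] mult_pos_pos[OF xy] by linarith
    then show "(sqrt x * sqrt y)\<^sup>2 \<le> (norm z)\<^sup>2" using xy by (simp add: nz power_mult_distrib)
  qed simp
  moreover have "(r + x) * (r + y) \<le> 2 * (r\<^sup>2 + (norm z)\<^sup>2)"
  proof -
    have "2 * (r\<^sup>2 + (x\<^sup>2 + y\<^sup>2)) - (r + x) * (r + y)
        = ((r - x)\<^sup>2 + (r - y)\<^sup>2 + (x - y)\<^sup>2) / 2 + (x\<^sup>2 + y\<^sup>2)"
      by (simp add: field_simps power2_eq_square)
    moreover have "\<dots> \<ge> 0" by simp
    ultimately show ?thesis unfolding nz by linarith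
  qed
  ultimately have "(sqrt x * sqrt y) * ((r + x) * (r + y)) \<le> norm z * (2 * (r\<^sup>2 + (norm z)\<^sup>2))"
    using xy r by (intro mult_mono[of "sqrt x * sqrt y"]) auto
  then have "2 * r\<^sup>2 / (norm z * (2 * (r\<^sup>2 + (norm z)\<^sup>2))) \<le> 2 * r\<^sup>2 / ((sqrt x * sqrt y) * ((r + x) * (r + y)))"
    using xy r z by (intro divide_left_mono mult_pos_pos add_pos_pos) auto
  moreover have "2 * r\<^sup>2 / (norm z * (2 * (r\<^sup>2 + (norm z)\<^sup>2))) = decay_kernel r z"
    unfolding decay_kernel_def by (subst mult.left_commute, subst mult_divide_mult_cancel_left) auto
  moreover have "2 * r\<^sup>2 / ((sqrt x * sqrt y) * ((r + x) * (r + y))) = 2 * r * ((sqrt r / (sqrt x * (r + x))) * (sqrt r / (sqrt y * (r + y))))"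
    using r by (simp add: power2_eq_square ac_simps)
  ultimately show ?thesis by (simp add: x_def y_def)
qed

lemma nn_integral_kernel_0:
  assumes r: "r > 0"
  shows "(\<integral>\<^sup>+z. ennreal (decay_kernel r z) \<partial>lborel) \<le> ennreal (8 * pi\<^sup>2 * r)"
proof -
  let ?g = "\<lambda>x. sqrt r / (sqrt \<bar>x\<bar> * (r + \<bar>x\<bar>))"
  \<comment> \<open>The axes must be excluded: there a factor of the product is a division by zero
    and has value 0.\<close>
  have ae: "AE z::complex in lborel. Re z \<noteq> 0 \<and> Im z \<noteq> 0"
    using AE_lborel_coordinate_neq[of "1::complex" 0] AE_lborel_coordinate_neq[of \<i> 0]
    by (auto simp: Basis_complex_def)
  have "(\<integral>\<^sup>+z. ennreal (decay_kernel r z) \<partial>lborel) \<le> (\<integral>\<^sup>+z. ennreal (2 * r) * ennreal (\<Prod>b\<in>(Basis::complex set). ?g (z \<bullet> b)) \<partial>lborel)"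
  proof (rule nn_integral_mono_AE, use ae in eventually_elim)
    case (elim z)
    have "(\<Prod>b\<in>(Basis::complex set). ?g (z \<bullet> b)) = ?g (Re z) * ?g (Im z)"
      by (simp add: Basis_complex_def)
    then show ?case
      using decay_kernel_le_product[OF r, of z] elim r
      by (simp flip: ennreal_mult'' add: prod_nonneg ennreal_leI mult.assoc)
  qed
  also have "\<dots> = ennreal (2 * r) * (\<integral>\<^sup>+z. ennreal (\<Prod>b\<in>(Basis::complex set). ?g (z \<bullet> b)) \<partial>lborel)"
    by (intro nn_integral_cmult) measurable
  also have "(\<integral>\<^sup>+z. ennreal (\<Prod>b\<in>(Basis::complex set). ?g (z \<bullet> b)) \<partial>lborel) = (\<Prod>b\<in>(Basis::complex set). (\<integral>\<^sup>+x. ?g x \<partial>lborel))"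
    using r by (subst prod_ennreal[symmetric], simp, subst nn_integral_lborel_prod[symmetric]) (auto intro!: prod_ennreal[symmetric] nn_integral_cong)
  also have "\<dots> = ennreal (2 * pi) * ennreal (2 * pi)"
    by (simp add: nn_integral_line_kernel[OF r] Basis_complex_def)
  also have "ennreal (2*r) * \<dots> = ennreal (8 * pi\<^sup>2 * r)"
    using r by (simp flip: ennreal_mult add: power2_eq_square)
  finally show ?thesis .
qed

text \<open>Reflection and translation preserve Lebesgue measure, so the bound is uniform in
  \<open>z\<close>. Its linear growth in \<open>r\<close> is what later balances the normalising
  factor h^2.\<close>

lemma decay_kernel_integrable_lborel:
  assumes r: "r > 0"
  shows "integrable lborel (\<lambda>\<zeta>. decay_kernel r (z - \<zeta>))" "(\<integral>\<zeta>. decay_kernel r (z - \<zeta>) \<partial>lborel) \<le> 8 * pi\<^sup>2 * r"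
proof -
  have "distr lborel borel (\<lambda>x. z + (-1) *\<^sub>R x) = (lborel::complex measure)"
    using lborel_affine[of "-1" z] by (simp add: density_1)
  then have "(\<integral>\<^sup>+z. ennreal (decay_kernel r z) \<partial>lborel) = (\<integral>\<^sup>+z. ennreal (decay_kernel r z) \<partial>(distr lborel borel (\<lambda>x. z + (-1) *\<^sub>R x)))"
    by simp
  also have "\<dots> = (\<integral>\<^sup>+\<zeta>. ennreal (decay_kernel r (z - \<zeta>)) \<partial>lborel)"
    by (subst nn_integral_distr) auto
  finally have *: "(\<integral>\<^sup>+\<zeta>. ennreal (decay_kernel r (z - \<zeta>)) \<partial>lborel) \<le> ennreal (8 * pi\<^sup>2 * r)"
    using nn_integral_kernel_0[OF r] by simp
  show i: "integrable lborel (\<lambda>\<zeta>. decay_kernel r (z - \<zeta>))"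
    by (rule integrableI_nonneg) (use * in \<open>auto simp: decay_kernel_nonneg less_top[symmetric] top_unique\<close>)
  show "(\<integral>\<zeta>. decay_kernel r (z - \<zeta>) \<partial>lborel) \<le> 8 * pi\<^sup>2 * r"
    using * r by (subst (asm) nn_integral_eq_integral[OF i]) (auto simp: decay_kernel_nonneg)
qed

subsection \<open>Bounded holomorphic functions off an arc\<close>

text \<open>The Schwarz lemma: the quotient f w / w has a removable singularity at 0, the maximum
  principle on a disc of radius s < R bounds it by M / s, and s tends to R.\<close>

lemma holomorphic_factor_at_zero:
  fixes f :: "complex \<Rightarrow> complex"
  assumes f: "f holomorphic_on ball 0 R" and f0: "f 0 = 0" and R: "R > 0"
    and M: "\<And>w. w \<in> ball 0 R \<Longrightarrow> norm (f w) \<le> M"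
  obtains g where "g holomorphic_on ball 0 R" "\<And>w. w \<in> ball 0 R \<Longrightarrow> f w = w * g w"
    "\<And>w. w \<in> ball 0 R \<Longrightarrow> norm (g w) \<le> M / R" "g 0 = deriv f 0"
proof -
  define g where "g = (\<lambda>w. if w = 0 then deriv f 0 else f w / w)"
  have g: "g holomorphic_on ball 0 R"
    using pole_lemma_open[OF f open_ball, of 0] unfolding g_def by (simp only: f0 diff_0_right)
  have "norm (g w) \<le> M / R" if w: "w \<in> ball 0 R" for w
  proof -
    have le: "norm (g w) \<le> M / s" if s: "norm w < s" "s < R" for s
    proof -
      have s0: "s > 0" using s norm_ge_zero[of w] by linarith
      have "cball 0 s \<subseteq> ball (0::complex) R" using s by auto
      then have "g holomorphic_on cball 0 s" using g by (rule holomorphic_on_subset[rotated])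
      then have g': "g holomorphic_on interior (cball 0 s)" "continuous_on (closure (cball 0 s)) g"
        using s0 by (auto intro: holomorphic_on_imp_continuous_on holomorphic_on_subset)
      have fr: "norm (g v) \<le> M / s" if "v \<in> frontier (cball 0 s)" for v
      proof -
        have v: "norm v = s" "v \<noteq> 0" using that s0 by auto
        then have "norm (f v) \<le> M" using s by (intro M) auto
        then show ?thesis using v s0 by (simp add: g_def norm_divide divide_right_mono)
      qed
      show ?thesis
        by (rule maximum_modulus_frontier[OF g' bounded_cball fr]) (use s in auto)
    qed
    have ev: "\<forall>\<^sub>F s in at_left R. norm (g w) \<le> M / s"
    proof (rule eventually_at_leftI)
      fix s assume "s \<in> {norm w<..<R}"
      then show "norm (g w) \<le> M / s" by (intro le) auto
    qed (use w in simp)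
    have lim: "((\<lambda>s. M / s) \<longlongrightarrow> M / R) (at_left R)"
      using R by (intro tendsto_intros) auto
    show ?thesis
      by (rule tendsto_lowerbound[OF lim ev trivial_limit_at_left_real])
  qed
  with that[of g] g show ?thesis using f0 by (auto simp: g_def)
qed

text \<open>The set \<open>W\<close> is the complement of the arc in the sphere, seen through \<open>w = 1 / (z - a)\<close>.\<close>
lemma simply_connected_inversion_arc_complement:
  fixes \<gamma> :: "real \<Rightarrow> complex"
  assumes arc: "arc \<gamma>" and a: "pathstart \<gamma> = a" and sub: "path_image \<gamma> \<subseteq> cball a r" and r: "r > 0"
  defines "W \<equiv> {w. w = 0 \<or> a + 1 / w \<notin> path_image \<gamma>}"
  shows "open W" "ball 0 (1 / r) \<subseteq> W" "simply_connected W"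
proof -
  let ?E = "path_image \<gamma>" and ?i = "\<lambda>z. 1 / (z - a)"
  have aE: "a \<in> ?E" using a by (auto intro: pathstart_in_path_image)
  have b: "ball 0 (1 / r) \<subseteq> W"
  proof
    fix w :: complex assume w: "w \<in> ball 0 (1 / r)"
    show "w \<in> W"
    proof (cases "w = 0")
      case False
      then have "norm (1 / w) > r" using w r by (simp add: norm_divide field_simps)
      then have "a + 1 / w \<notin> cball a r" by (simp add: dist_norm norm_divide)
      then show ?thesis using sub by (auto simp: W_def)
    qed (simp add: W_def)
  qed
  \<comment> \<open>The disc makes openness at 0 visible; \<open>W\<close> is connected because the
    disc meets the image of the complement of the arc, and an arc does not separate the
    plane.\<close>
  have W: "W = ball 0 (1 / r) \<union> {w \<in> - {0}. a + 1 / w \<in> - ?E}"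
    using b r by (auto simp: W_def)
  have "open {w \<in> - {0}. a + 1 / w \<in> - ?E}"
  proof -
    have "continuous_on (- {0}) (\<lambda>w. a + 1 / w)" by (auto intro!: continuous_intros)
    then have "open (- {0} \<inter> (\<lambda>w. a + 1 / w) -` (- ?E))"
      using arc by (intro continuous_open_preimage) (auto simp: closed_arc_image open_Compl)
    moreover have "- {0} \<inter> (\<lambda>w. a + 1 / w) -` (- ?E) = {w \<in> - {0}. a + 1 / w \<in> - ?E}" by auto
    ultimately show ?thesis by metis
  qed
  then show op: "open W" unfolding W by auto
  show "ball 0 (1 / r) \<subseteq> W" by fact
  have im: "{w \<in> - {0}. a + 1 / w \<in> - ?E} = ?i ` (- ?E)"
  proof (intro equalityI subsetI)
    fix w assume "w \<in> {w \<in> - {0}. a + 1 / w \<in> - ?E}"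
    then show "w \<in> ?i ` (- ?E)" by (intro image_eqI[of _ _ "a + 1 / w"]) auto
  next
    fix w assume "w \<in> ?i ` (- ?E)"
    then obtain z where z: "z \<notin> ?E" "w = ?i z" by auto
    then have "z \<noteq> a" using aE by auto
    then show "w \<in> {w \<in> - {0}. a + 1 / w \<in> - ?E}" using z by auto
  qed
  have "connected (?i ` (- ?E))"
    by (intro connected_continuous_image connected_arc_complement arc continuous_intros)
       (use aE in auto)
  moreover have "ball 0 (1 / r) \<inter> {w \<in> - {0}. a + 1 / w \<in> - ?E} \<noteq> {}"
  proof -
    have "complex_of_real (1 / (2 * r)) \<in> ball 0 (1 / r)" using r by (simp add: field_simps norm_divide)
    moreover have "complex_of_real (1 / (2 * r)) \<noteq> 0" using r by simp
    ultimately show ?thesis using b unfolding W_def by blast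
  qed
  ultimately have con: "connected W" unfolding W im[symmetric] by (intro connected_Un) auto
  \<comment> \<open>The inversion sends the starting point \<open>a\<close> to infinity, so the rest
    of the arc becomes a connected unbounded set. The complement of \<open>W\<close> thus has no
    bounded component, which makes the connected open set \<open>W\<close> simply connected.\<close>
  have cW: "- W = (\<lambda>t. ?i (\<gamma> t)) ` {0<..1}"
  proof (intro equalityI subsetI)
    fix w assume "w \<in> - W"
    then have w: "w \<noteq> 0" "a + 1 / w \<in> ?E" by (auto simp: W_def)
    then obtain t where t: "t \<in> {0..1}" "a + 1 / w = \<gamma> t" by (auto simp: path_image_def)
    have "t \<noteq> 0" using t w a by (auto simp: pathstart_def)
    moreover have "w = ?i (\<gamma> t)" using t(2)[symmetric] w by simp
    ultimately show "w \<in> (\<lambda>t. ?i (\<gamma> t)) ` {0<..1}" using t by force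
  next
    fix w assume "w \<in> (\<lambda>t. ?i (\<gamma> t)) ` {0<..1}"
    then obtain t where t: "0 < t" "t \<le> 1" "w = ?i (\<gamma> t)" by auto
    have "\<gamma> t \<noteq> a" using arcD[OF arc, of t 0] t a by (auto simp: pathstart_def)
    then show "w \<in> - W" using t by (auto simp: W_def path_image_def)
  qed
  have ne: "\<gamma> t \<noteq> a" if "t \<in> {0<..1}" for t
    using arcD[OF arc, of t 0] that a by (auto simp: pathstart_def)
  have cont: "continuous_on {0..1} \<gamma>" using arc by (simp add: arc_def path_def)
  have ccW: "connected (- W)" unfolding cW
    by (intro connected_continuous_image continuous_intros continuous_on_subset[OF cont])
       (use ne in auto)
  have unb: "\<not> bounded (- W)"
  proof
    assume "bounded (- W)"
    then obtain B where B: "B > 0" "\<And>w. w \<in> - W \<Longrightarrow> norm w \<le> B" by (auto simp: bounded_pos)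
    have "\<exists>d>0. \<forall>t\<in>{0..1}. dist t 0 < d \<longrightarrow> dist (\<gamma> t) (\<gamma> 0) < 1 / B"
      using cont B(1) unfolding continuous_on_iff by (elim ballE[of _ _ 0] allE[of _ "1 / B"]) auto
    then obtain d where d: "d > 0" "\<And>t. t \<in> {0..1} \<Longrightarrow> dist t 0 < d \<Longrightarrow> dist (\<gamma> t) a < 1 / B"
      using a by (auto simp: pathstart_def)
    define t where "t = min 1 (d / 2)"
    have t: "t \<in> {0<..1}" "dist t 0 < d" using d by (auto simp: t_def)
    have "norm (?i (\<gamma> t)) \<le> B" using B(2) t(1) unfolding cW by blast
    then show False using d(2)[of t] t ne[of t] B(1)
      by (simp add: dist_norm norm_divide field_simps)
  qed
  have "- W \<noteq> {}" using unb by auto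
  then have "components (- W) = {- W}" using ccW by (metis components_eq_sing_iff)
  then show "simply_connected W"
    using con unb op by (simp add: simply_connected_eq_unbounded_complement_components)
qed

text \<open>A lower bound, proportional to \<open>r\<close>, for the analytic capacity of the arc:
  in the coordinate w = 1 / (z - a) the function \<open>G\<close> is w + O(w^2) at infinity and yet
  bounded by 44 / r. With c = q - a the quotient (z - a) / (z - q) becomes 1 / (1 - c w).\<close>

lemma analytic_capacity_arc:
  fixes \<gamma> :: "real \<Rightarrow> complex"
  assumes arc: "arc \<gamma>" and a: "pathstart \<gamma> = a" and q: "pathfinish \<gamma> = q"
    and sub: "path_image \<gamma> \<subseteq> cball a r" and r: "r = dist a q"
  defines "W \<equiv> {w. w = 0 \<or> a + 1 / w \<notin> path_image \<gamma>}"
  obtains G where "G holomorphic_on W" "\<And>w. w \<in> W \<Longrightarrow> norm (G w) \<le> 44 / r" "G 0 = 0" "deriv G 0 = 1"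
proof -
  define c where "c = q - a"
  have "q \<noteq> a" using arc a q by (metis arc_distinct_ends)
  then have c0: "c \<noteq> 0" and cr: "norm c = r" and r0: "r > 0"
    by (auto simp: c_def r dist_norm norm_minus_commute)
  note W = simply_connected_inversion_arc_complement[OF arc a sub r0, folded W_def]
  have nz: "1 - c * w \<noteq> 0" if "w \<in> W" for w
  proof
    assume "1 - c * w = 0"
    then have w: "w = 1 / c" using c0 by (simp add: field_simps)
    have "q \<in> path_image \<gamma>" using q by (auto intro: pathfinish_in_path_image)
    then show False using that w c0 by (auto simp: W_def c_def)
  qed
  have "\<exists>g. g holomorphic_on W \<and> (\<forall>w\<in>W. 1 / (1 - c * w) = (g w)\<^sup>2)"
  proof -
    have "(\<lambda>w. 1 / (1 - c * w)) holomorphic_on W" using nz by (auto intro!: holomorphic_intros)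
    moreover have "\<forall>w\<in>W. 1 / (1 - c * w) \<noteq> 0" using nz by simp
    ultimately show ?thesis using W(3) unfolding simply_connected_eq_holomorphic_sqrt[OF W(1)] by blast
  qed
  then obtain s0 where s0: "s0 holomorphic_on W" "\<And>w. w \<in> W \<Longrightarrow> (s0 w)\<^sup>2 = 1 / (1 - c * w)" by metis
  have 0: "0 \<in> W" by (simp add: W_def)
  have "(s0 0)\<^sup>2 = 1" using s0(2)[OF 0] by simp
  \<comment> \<open>Since \<open>s0 0\<close> is 1 or -1, multiplying by it selects the branch with
    value 1 at 0.\<close>
  define s where "s = (\<lambda>w. s0 0 * s0 w)"
  have s: "s holomorphic_on W" "\<And>w. w \<in> W \<Longrightarrow> (s w)\<^sup>2 = 1 / (1 - c * w)" "s 0 = 1"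
    using s0 \<open>(s0 0)\<^sup>2 = 1\<close> by (auto simp: s_def power_mult_distrib simp flip: power2_eq_square intro!: holomorphic_intros)
  have re_sq: "Re ((s w)\<^sup>2) > 0" if "w \<in> ball 0 (1 / r)" for w
  proof -
    have "norm (c * w) < 1" using that r0 cr by (simp add: norm_mult field_simps)
    then have "Re (1 - c * w) > 0" using complex_Re_le_cmod[of "c * w"] by simp
    then have "Re (inverse (1 - c * w)) > 0"
      unfolding inverse_complex.sel by (intro divide_pos_pos) (auto simp: sum_power2_gt_zero_iff)
    then show ?thesis using s(2) W(2) that by (auto simp: divide_inverse)
  qed
  \<comment> \<open>If the real part of \<open>s\<close> vanished at a point, the square of
    \<open>s\<close> there would have real part at most 0, against \<open>re_sq\<close>; so by
    connectedness the sign of Re s at 0 persists on the disc.\<close>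
  have re: "Re (s w) > 0" if w: "w \<in> ball 0 (1 / r)" for w
  proof (rule ccontr)
    assume "\<not> Re (s w) > 0"
    have "continuous_on (ball 0 (1 / r)) (\<lambda>w. Re (s w))"
      using W(2) by (intro continuous_intros holomorphic_on_imp_continuous_on holomorphic_on_subset[OF s(1)])
    then have "connected ((\<lambda>w. Re (s w)) ` ball 0 (1 / r))"
      by (intro connected_continuous_image) auto
    moreover have "Re (s w) \<in> (\<lambda>w. Re (s w)) ` ball 0 (1 / r)" using w by blast
    moreover have "Re (s 0) \<in> (\<lambda>w. Re (s w)) ` ball 0 (1 / r)" using r0 by (intro imageI) auto
    ultimately have "0 \<in> (\<lambda>w. Re (s w)) ` ball 0 (1 / r)"
      using \<open>\<not> Re (s w) > 0\<close> s(3) by (auto simp: connected_iff_interval)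
    then obtain v where "v \<in> ball 0 (1 / r)" "Re (s v) = 0" by auto
    then show False using re_sq[of v] by (simp add: power2_eq_square)
  qed
  \<comment> \<open>otherwise \<open>- s w\<close>, being close to \<open>1\<close>, is also a value of \<open>s\<close>, taken at the same \<open>w\<close>\<close>
  have far: "norm (s w + 1) \<ge> 1 / 5" if w: "w \<in> W" for w
  proof (rule ccontr)
    assume "\<not> norm (s w + 1) \<ge> 1 / 5"
    define e u where "e = - (s w + 1)" and "u = - s w"
    have e: "norm e < 1 / 5" "u = 1 + e"
      using \<open>\<not> norm (s w + 1) \<ge> 1 / 5\<close> unfolding e_def u_def norm_minus_cancel by simp_all
    have u2: "u\<^sup>2 = 1 / (1 - c * w)" using s(2)[OF w] by (simp add: u_def)
    \<comment> \<open>The threshold 1/5 gives |2 e + e^2| \<le> 2/5 + 1/25 < 1/2, so |u^2 - 1| < 1/2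
      < |u^2|. Solving u^2 = 1 / (1 - c w) for c w then yields |c w| < 1, which puts
      \<open>w\<close> into the disc where Re s is positive, whereas s w = - 1 - e.\<close>
    have "norm e * norm e \<le> 1/5 * (1 / 5)" using e by (intro mult_mono) auto
    then have "norm (2 * e + e * e) < 1 / 2"
      using norm_triangle_ineq[of "2 * e" "e * e"] e by (simp add: norm_mult)
    moreover have "u\<^sup>2 = 1 + (2 * e + e * e)" by (simp add: e(2) power2_eq_square algebra_simps)
    ultimately have u1: "norm (u\<^sup>2 - 1) < 1 / 2" by simp
    then have u3: "norm (u\<^sup>2) > 1 / 2"
      using norm_triangle_sub[of 1 "u\<^sup>2"] norm_minus_commute[of 1 "u\<^sup>2"] by simp
    have "c * w = (u\<^sup>2 - 1) / u\<^sup>2"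
      using nz[OF w] unfolding u2 by (simp add: field_simps)
    then have "norm (c * w) = norm (u\<^sup>2 - 1) / norm (u\<^sup>2)" by (simp only: norm_divide)
    then have "norm (c * w) < 1" using u1 u3 by (simp only: divide_less_eq_1) linarith
    then have "w \<in> ball 0 (1 / r)" using r0 cr by (simp add: norm_mult field_simps)
    from re[OF this] have "Re (s w) > 0" .
    moreover have "\<bar>Re e\<bar> < 1 / 5" using abs_Re_le_cmod[of e] e(1) by linarith
    ultimately show False using e(2) by (simp add: u_def e_def)
  qed
  \<comment> \<open>normalised by \<open>s w = 1 + c w / 2 + \<dots>\<close>\<close>
  define G where "G = (\<lambda>w. (- 8 / c) * (1 / (s w + 1) - 1 / 2))"
  have "s w + 1 \<noteq> 0" if "w \<in> W" for w using far[OF that] by auto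
  then have "G holomorphic_on W" using s unfolding G_def by (intro holomorphic_intros) auto
  moreover have "norm (G w) \<le> 44 / r" if w: "w \<in> W" for w
  proof -
    have "norm (1 / (s w + 1)) \<le> 5" using far[OF w] by (simp add: norm_divide divide_simps split: if_splits)
    \<comment> \<open>The constant 44 is 8 * 11/2, with 11/2 = 5 + 1/2.\<close>
    then have "norm (1 / (s w + 1) - 1 / 2) \<le> 11 / 2"
      using norm_triangle_ineq4[of "1 / (s w + 1)" "1/2"] by simp
    then have "8 / r * norm (1 / (s w + 1) - 1 / 2) \<le> 8 / r * (11 / 2)"
      using r0 by (intro mult_left_mono) auto
    moreover have "norm (G w) = norm (- 8 / c) * norm (1 / (s w + 1) - 1 / 2)" by (simp only: G_def norm_mult)
    moreover have "norm (- 8 / c) = 8 / r" by (simp add: norm_divide cr)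
    ultimately show ?thesis by simp
  qed
  moreover have "G 0 = 0" by (simp add: G_def s(3))
  moreover have "deriv G 0 = 1"
  proof -
    have ds: "(s has_field_derivative deriv s 0) (at 0)"
      using holomorphic_derivI[OF s(1) W(1) 0] .
    have "((\<lambda>w. (s w)\<^sup>2) has_field_derivative 2 * deriv s 0) (at 0)"
      using ds by (auto intro!: derivative_eq_intros simp: s(3))
    moreover have "((\<lambda>w. (s w)\<^sup>2) has_field_derivative c) (at 0)"
    proof (rule has_field_derivative_transform_within_open[OF _ W(1) 0])
      show "((\<lambda>w. 1 / (1 - c * w)) has_field_derivative c) (at 0)"
        by (auto intro!: derivative_eq_intros)
    qed (simp add: s(2))
    ultimately have "2 * deriv s 0 = c" by (rule DERIV_unique)
    then have "(- 8 / c) * (- deriv s 0 / 4) = 1" using c0 by (simp add: field_simps)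
    moreover have "(G has_field_derivative (- 8 / c) * (- deriv s 0 / 4)) (at 0)"
      unfolding G_def using ds c0 by (auto intro!: derivative_eq_intros simp: s(3))
    ultimately have "(G has_field_derivative 1) (at 0)" by simp
    then show ?thesis by (rule DERIV_imp_deriv)
  qed
  ultimately show ?thesis using that by blast
qed

section \<open>Imitation of the Cauchy kernel by functions holomorphic off an arc\<close>

text \<open>Put w = 1 / (z - a) and d = \<zeta> - a. The Cauchy kernel is w + d w^2 + O(w^3) and g
  is w + \<beta> w^2 + O(w^3), so g + (d - \<beta>) g^2 agrees with it up to O(w^3); hence b = a +
  \<beta>. The same \<open>g\<close> and \<open>b\<close> serve all \<zeta> in the disc, and the
  imitation is affine in \<zeta>; this permits integrating it over a grid cell.\<close>

lemma arc_cauchy_kernel_approx: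
  fixes \<gamma> :: "real \<Rightarrow> complex"
  assumes arc: "arc \<gamma>" and a: "pathstart \<gamma> = a" and q: "pathfinish \<gamma> = q"
    and sub: "path_image \<gamma> \<subseteq> cball a r" and r: "r = dist a q"
  obtains g b where "g holomorphic_on - path_image \<gamma>"
    "\<And>\<zeta> z. \<lbrakk>\<zeta> \<in> cball a r; z \<notin> path_image \<gamma>; z \<noteq> \<zeta>\<rbrakk> \<Longrightarrow>
       norm (1 / (z - \<zeta>) - (g z + (\<zeta> - b) * (g z)\<^sup>2)) \<le> 3000000 * decay_kernel r (z - \<zeta>)"
proof -
  define W where "W = {w. w = 0 \<or> a + 1 / w \<notin> path_image \<gamma>}"
  have "q \<noteq> a" using arc a q by (metis arc_distinct_ends)
  then have r0: "r > 0" by (auto simp: r)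
  have aE: "a \<in> path_image \<gamma>" using a by (auto intro: pathstart_in_path_image)
  note W = simply_connected_inversion_arc_complement[OF arc a sub r0, folded W_def]
  obtain G where G: "G holomorphic_on W" "\<And>w. w \<in> W \<Longrightarrow> norm (G w) \<le> 44 / r" "G 0 = 0" "deriv G 0 = 1"
    using analytic_capacity_arc[OF arc a q sub r] unfolding W_def by blast
  let ?R = "1 / r"
  have R: "?R > 0" using r0 by simp
  have holG: "G holomorphic_on ball 0 ?R" using G(1) W(2) by (rule holomorphic_on_subset)
  have bG: "norm (G w) \<le> 44 / r" if "w \<in> ball 0 ?R" for w using G(2) W(2) that by blast
  obtain G1 where G1: "G1 holomorphic_on ball 0 ?R" "\<And>w. w \<in> ball 0 ?R \<Longrightarrow> G w = w * G1 w"
    "\<And>w. w \<in> ball 0 ?R \<Longrightarrow> norm (G1 w) \<le> (44 / r) / ?R" "G1 0 = deriv G 0"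
    by (rule holomorphic_factor_at_zero[OF holG G(3) R], erule bG, rule that)
  have b1: "norm (G1 w) \<le> 44" if "w \<in> ball 0 ?R" for w using G1(3)[OF that] r0 by simp
  have hol1: "(\<lambda>w. G1 w - 1) holomorphic_on ball 0 ?R" using G1(1) by (intro holomorphic_intros)
  have b1': "norm (G1 w - 1) \<le> 45" if "w \<in> ball 0 ?R" for w
    using norm_triangle_ineq4[of "G1 w" 1] b1[OF that] by simp
  have z1: "G1 0 - 1 = 0" using G1(4) G(4) by simp
  obtain G2 where G2: "G2 holomorphic_on ball 0 ?R" "\<And>w. w \<in> ball 0 ?R \<Longrightarrow> G1 w - 1 = w * G2 w"
    "\<And>w. w \<in> ball 0 ?R \<Longrightarrow> norm (G2 w) \<le> 45 / ?R"
    by (rule holomorphic_factor_at_zero[OF hol1 z1 R], erule b1', rule that)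
  \<comment> \<open>Two factorisations give G w = w + w^2 G2 w, so \<beta> is the second Taylor
    coefficient of \<open>G\<close> at 0.\<close>
  define \<beta> where "\<beta> = G2 0"
  have b2: "norm (G2 w) \<le> 45 * r" if "w \<in> ball 0 ?R" for w using G2(3)[OF that] r0 by simp
  have b\<beta>: "norm \<beta> \<le> 45 * r" unfolding \<beta>_def using r0 by (intro b2) auto
  define g where "g = (\<lambda>z. G (1 / (z - a)))"
  have inW: "1 / (z - a) \<in> W" if "z \<notin> path_image \<gamma>" for z using that by (auto simp: W_def)
  have "g holomorphic_on - path_image \<gamma>"
    unfolding g_def using aE inW
    by (intro holomorphic_on_compose_gen[OF _ G(1), unfolded o_def] holomorphic_intros) auto
  moreover have "norm (1 / (z - \<zeta>) - (g z + (\<zeta> - (a + \<beta>)) * (g z)\<^sup>2)) \<le> 3000000 * decay_kernel r (z - \<zeta>)"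
    if \<zeta>: "\<zeta> \<in> cball a r" and z: "z \<notin> path_image \<gamma>" and ne: "z \<noteq> \<zeta>" for \<zeta> z
  proof -
    define d where "d = \<zeta> - a"
    define w where "w = 1 / (z - a)"
    define t where "t = norm (z - \<zeta>)"
    define \<mu> where "\<mu> = d - \<beta>"
    have d: "norm d \<le> r" using \<zeta> by (simp add: d_def dist_norm norm_minus_commute)
    have za: "z \<noteq> a" using aE z by auto
    have t0: "t > 0" using ne by (simp add: t_def)
    have b\<mu>: "norm \<mu> \<le> 46 * r" using norm_triangle_ineq4[of d \<beta>] d b\<beta> by (simp add: \<mu>_def)
    have kern: "decay_kernel r (z - \<zeta>) = r\<^sup>2 / (t * (r\<^sup>2 + t\<^sup>2))" by (simp add: decay_kernel_def t_def)
    show ?thesis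
    proof (cases "norm (z - a) \<le> 2 * r")
      case True
      then have t3: "t \<le> 3 * r" using norm_triangle_ineq4[of "z - a" d] d by (simp add: t_def d_def)
      have gz: "norm (g z) \<le> 44 / r" unfolding g_def by (intro G(2) inW z)
      have "norm (\<mu> * (g z)\<^sup>2) \<le> (46 * r) * (44 / r)\<^sup>2"
        unfolding norm_mult norm_power using b\<mu> gz r0 by (intro mult_mono power_mono) auto
      also have "\<dots> = 89056 / r" using r0 by (simp add: power2_eq_square field_simps)
      finally have "norm (g z + \<mu> * (g z)\<^sup>2) \<le> 89100 / r"
        using gz norm_triangle_ineq[of "g z" "\<mu> * (g z)\<^sup>2"] by (simp add: add_divide_distrib[symmetric])
      also have "\<dots> \<le> 89100 * (3 / t)" using t3 t0 r0 by (simp add: field_simps)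
      finally have "norm (1 / (z - \<zeta>) - (g z + \<mu> * (g z)\<^sup>2)) \<le> 1 / t + 89100 * (3 / t)"
        using norm_triangle_ineq4[of "1 / (z - \<zeta>)" "g z + \<mu> * (g z)\<^sup>2"] by (simp add: norm_divide t_def)
      also have "\<dots> = 267301 / t" by (simp add: add_divide_distrib[symmetric])
      also have "\<dots> \<le> 3000000 * (r\<^sup>2 / (t * (r\<^sup>2 + t\<^sup>2)))"
      proof -
        have "t\<^sup>2 \<le> (3 * r)\<^sup>2" using t3 t0 by (intro power_mono) auto
        then have "t\<^sup>2 \<le> 9 * r\<^sup>2" by (simp add: power_mult_distrib)
        then have "267301 * (r\<^sup>2 + t\<^sup>2) \<le> 267301 * (r\<^sup>2 + 9 * r\<^sup>2)"
          by (intro mult_left_mono add_left_mono) auto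
        also have "\<dots> = 2673010 * r\<^sup>2" by simp
        also have "\<dots> \<le> 3000000 * r\<^sup>2" by (intro mult_right_mono) auto
        finally have "267301 * (r\<^sup>2 + t\<^sup>2) \<le> 3000000 * r\<^sup>2" .
        moreover have "r\<^sup>2 + t\<^sup>2 > 0" using r0 by (intro add_pos_nonneg) auto
        ultimately have "267301 \<le> 3000000 * r\<^sup>2 / (r\<^sup>2 + t\<^sup>2)" by (simp add: pos_le_divide_eq)
        then have "267301 / t \<le> 3000000 * r\<^sup>2 / (r\<^sup>2 + t\<^sup>2) / t" using t0 by (intro divide_right_mono) auto
        then show ?thesis by (simp add: mult.commute)
      qed
      finally show ?thesis by (simp add: kern \<mu>_def d_def algebra_simps)
    next
      case False
      then have big: "norm (z - a) > 2 * r" by simp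
      \<comment> \<open>Half the radius 1 / r keeps 1 - d v away from 0 for every |d| \<le>
        r.\<close>
      let ?S = "1 / (2 * r)"
      have S: "?S > 0" using r0 by simp
      have sub': "ball 0 ?S \<subseteq> ball (0::complex) ?R" using r0 by (auto simp: field_simps)
      have nd: "norm (1 - d * v) \<ge> 1 / 2" if "v \<in> ball 0 ?S" for v
      proof -
        have "norm d * norm v \<le> r * ?S" using that d r0 by (intro mult_mono) auto
        then have "norm (d * v) \<le> 1 / 2" using r0 by (simp add: norm_mult)
        then show ?thesis using norm_triangle_ineq2[of 1 "d * v"] by simp
      qed
      then have nd0: "1 - d * v \<noteq> 0" if "v \<in> ball 0 ?S" for v using that by fastforce
      \<comment> \<open>the difference of \<open>g + \<mu> g\<^sup>2\<close> and the Cauchy kernel is \<open>w\<^sup>2 \<psi> w\<close>, and \<open>\<mu>\<close> is chosen so that \<open>\<psi> 0 = 0\<close>\<close>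
      define \<psi> where "\<psi> = (\<lambda>v. G2 v + \<mu> * (G1 v)\<^sup>2 - d / (1 - d * v))"
      have hol\<psi>: "\<psi> holomorphic_on ball 0 ?S"
        unfolding \<psi>_def using nd0
        by (intro holomorphic_intros holomorphic_on_subset[OF G1(1) sub'] holomorphic_on_subset[OF G2(1) sub']) auto
      have \<psi>0: "\<psi> 0 = 0" by (simp add: \<psi>_def \<mu>_def G1(4) G(4) flip: \<beta>_def)
      \<comment> \<open>The three terms of \<psi> contribute 45 r, 46 * 44^2 r = 89056 r and 2
        r.\<close>
      have b\<psi>: "norm (\<psi> v) \<le> 89103 * r" if v: "v \<in> ball 0 ?S" for v
      proof -
        have vR: "v \<in> ball 0 ?R" using v sub' by blast
        have "norm (\<mu> * (G1 v)\<^sup>2) \<le> (46 * r) * 44\<^sup>2"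
          unfolding norm_mult norm_power using b\<mu> b1[OF vR] r0 by (intro mult_mono power_mono) auto
        moreover have "norm (d / (1 - d * v)) \<le> r / (1 / 2)"
          unfolding norm_divide using d nd[OF v] r0 by (intro frac_le) auto
        ultimately show ?thesis
          using b2[OF vR] norm_triangle_ineq4[of "G2 v + \<mu> * (G1 v)\<^sup>2" "d / (1 - d * v)"]
            norm_triangle_ineq[of "G2 v" "\<mu> * (G1 v)\<^sup>2"]
          unfolding \<psi>_def by simp
      qed
      obtain \<theta> where \<theta>: "\<And>v. v \<in> ball 0 ?S \<Longrightarrow> \<psi> v = v * \<theta> v"
        "\<And>v. v \<in> ball 0 ?S \<Longrightarrow> norm (\<theta> v) \<le> 89103 * r / ?S"
        by (rule holomorphic_factor_at_zero[OF hol\<psi> \<psi>0 S], erule b\<psi>, rule that)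
      have "norm (z - a) > 0" using za by simp
      then have wS: "w \<in> ball 0 ?S" using big r0 by (simp add: w_def norm_divide field_simps)
      then have wR: "w \<in> ball 0 ?R" using sub' by blast
      have "z - \<zeta> = (1 - d * w) / w" using za by (simp add: w_def d_def field_simps)
      then have cauchy: "1 / (z - \<zeta>) = w / (1 - d * w)" by simp
      have G1w: "G1 w = 1 + w * G2 w" using G2(2)[OF wR] by (simp add: algebra_simps)
      have gz: "g z = w * G1 w" using G1(2)[OF wR] by (simp add: g_def w_def)
      have "g z + \<mu> * (g z)\<^sup>2 - 1 / (z - \<zeta>) = w * (G1 w + \<mu> * w * (G1 w)\<^sup>2 - 1 / (1 - d * w))"
        unfolding cauchy gz by (simp add: algebra_simps power2_eq_square)
      also have "G1 w + \<mu> * w * (G1 w)\<^sup>2 - 1 / (1 - d * w) = w * G2 w + \<mu> * w * (G1 w)\<^sup>2 + (1 - 1 / (1 - d * w))"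
        using G1w by simp
      also have "1 - 1 / (1 - d * w) = - (w * (d / (1 - d * w)))"
        using nd0[OF wS] by (simp add: field_simps)
      also have "w * (w * G2 w + \<mu> * w * (G1 w)\<^sup>2 + - (w * (d / (1 - d * w)))) = w\<^sup>2 * \<psi> w"
        by (simp add: \<psi>_def algebra_simps power2_eq_square)
      also have "\<dots> = w ^ 3 * \<theta> w" by (simp add: \<theta>(1)[OF wS] power2_eq_square power3_eq_cube)
      finally have "norm (g z + \<mu> * (g z)\<^sup>2 - 1 / (z - \<zeta>)) = norm w ^ 3 * norm (\<theta> w)"
        by (simp only: norm_mult norm_power)
      \<comment> \<open>The cube comes from w^2 in front of \<psi> and the zero of \<psi> at 0. In
        this region also r \<le> t, so 1 / t^3 is at most 2 / (t (r^2 + t^2)), and the constant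
        becomes about 1.2 million.\<close>
      also have "\<dots> \<le> (3 / (2 * t)) ^ 3 * (89103 * r / ?S)"
      proof (intro mult_mono power_mono \<theta>(2)[OF wS])
        have "t \<le> norm (z - a) + norm d" using norm_triangle_ineq4[of "z - a" d] by (simp add: t_def d_def)
        then have "2 * t \<le> 3 * norm (z - a)" using big d by linarith
        then show "norm w \<le> 3 / (2 * t)" using za t0 by (simp add: w_def norm_divide field_simps)
      qed (use t0 r0 in auto)
      also have "\<dots> = (27 * 89103 / 4) * (r\<^sup>2 / t ^ 3)"
        by (simp add: power3_eq_cube power2_eq_square)
      also have "\<dots> \<le> (27 * 89103 / 4) * (2 * (r\<^sup>2 / (t * (r\<^sup>2 + t\<^sup>2))))"
      proof -
        have "norm (z - a) \<le> t + norm d" using norm_triangle_ineq[of "z - \<zeta>" d] by (simp add: t_def d_def)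
        then have "r \<le> t" using big d by linarith
        then have "r\<^sup>2 \<le> t\<^sup>2" using r0 by (intro power_mono) auto
        then have "t * (r\<^sup>2 + t\<^sup>2) \<le> t * (2 * t\<^sup>2)" using t0 by (intro mult_left_mono) auto
        then have "t * (r\<^sup>2 + t\<^sup>2) \<le> 2 * t ^ 3" by (simp add: power2_eq_square power3_eq_cube)
        moreover have "t * (r\<^sup>2 + t\<^sup>2) > 0" using t0 r0 by (intro mult_pos_pos add_pos_pos) auto
        ultimately have "(2 * r\<^sup>2) / (2 * t ^ 3) \<le> (2 * r\<^sup>2) / (t * (r\<^sup>2 + t\<^sup>2))"
          by (intro frac_le) (assumption | simp)+
        then have "r\<^sup>2 / t ^ 3 \<le> 2 * (r\<^sup>2 / (t * (r\<^sup>2 + t\<^sup>2)))" by simp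
        then show ?thesis by (rule mult_left_mono) simp
      qed
      also have "\<dots> \<le> 3000000 * (r\<^sup>2 / (t * (r\<^sup>2 + t\<^sup>2)))"
      proof -
        have "0 \<le> r\<^sup>2 / (t * (r\<^sup>2 + t\<^sup>2))" using t0 by (intro divide_nonneg_nonneg mult_nonneg_nonneg) auto
        then show ?thesis by linarith
      qed
      finally show ?thesis
        by (subst norm_minus_commute) (simp add: kern \<mu>_def d_def algebra_simps)
    qed
  qed
  ultimately show ?thesis using that[of g "a + \<beta>"] by blast
qed

subsection \<open>Averages over squares as Cauchy transforms\<close>

text \<open>The Bochner integral over the whole line, cut off by an indicator, is the form in which
  contour integrals enter Fubini's theorem below.\<close>

lemma contour_integral_linepath_lborel:
  assumes "continuous_on (closed_segment a b) f"
  shows "contour_integral (linepath a b) f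
    = (\<integral>t. indicator {0..1} t *\<^sub>R ((b - a) * f (linepath a b t)) \<partial>lborel)"
proof -
  have "continuous_on {0..1} (\<lambda>t. (b - a) * f (linepath a b t))"
    by (intro continuous_intros continuous_on_compose2[OF assms])
       (auto simp: linepath_in_path)
  from set_borel_integral_eq_integral[OF borel_integrable_atLeastAtMost'[OF this]]
  have i: "((\<lambda>t. (b - a) * f (linepath a b t)) has_integral
      (LINT t:{0..1}|lborel. (b - a) * f (linepath a b t))) {0..1}"
    by (metis has_integral_integrable_integral)
  then have "(f has_contour_integral (LINT t:{0..1}|lborel. (b - a) * f (linepath a b t))) (linepath a b)"
    by (simp add: has_contour_integral_linepath mult.commute)
  then show ?thesis
    unfolding set_lebesgue_integral_def by (rule contour_integral_unique)
qed

lemma lborel_translation: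
  fixes F :: "complex \<Rightarrow> 'b :: {banach, second_countable_topology}"
  assumes [measurable]: "F \<in> borel_measurable borel"
  shows "(\<integral>x. F x \<partial>lborel) = (\<integral>x. F (c + x) \<partial>lborel)"
    "integrable lborel F \<longleftrightarrow> integrable lborel (\<lambda>x. F (c + x))"
proof -
  have "(\<integral>x. F x \<partial>lborel) = (\<integral>x. F x \<partial>distr lborel borel ((+) c))" by (simp add: lborel_distr_plus)
  also have "\<dots> = (\<integral>x. F (c + x) \<partial>lborel)" by (rule integral_distr) auto
  finally show "(\<integral>x. F x \<partial>lborel) = (\<integral>x. F (c + x) \<partial>lborel)" .
  have "integrable lborel F \<longleftrightarrow> integrable (distr lborel borel ((+) c)) F" by (simp add: lborel_distr_plus)
  also have "\<dots> \<longleftrightarrow> integrable lborel (\<lambda>x. F (c + x))" by (rule integrable_distr_eq) auto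
  finally show "integrable lborel F \<longleftrightarrow> integrable lborel (\<lambda>x. F (c + x))" .
qed

lemma inverse_le_kernel:
  assumes "r > 0" "norm z \<le> r"
  shows "1 / norm z \<le> 2 * decay_kernel r z"
proof (cases "z = 0")
  case False
  have "(norm z)\<^sup>2 \<le> r\<^sup>2" using assms by (intro power_mono) auto
  moreover have p: "r\<^sup>2 + (norm z)\<^sup>2 > 0" using assms by (intro add_pos_nonneg) auto
  ultimately have "1 \<le> 2 * r\<^sup>2 / (r\<^sup>2 + (norm z)\<^sup>2)" by simp
  then have "1 / norm z \<le> 2 * r\<^sup>2 / (r\<^sup>2 + (norm z)\<^sup>2) / norm z" by (intro divide_right_mono) auto
  then show ?thesis by (simp add: decay_kernel_def mult.commute)
qed (simp add: decay_kernel_def)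

lemma cauchy_transform_integrable:
  fixes v :: "complex \<Rightarrow> complex"
  assumes v [measurable]: "v \<in> borel_measurable borel" and M: "\<And>\<zeta>. norm (v \<zeta>) \<le> M"
    and supp: "\<And>\<zeta>. norm \<zeta> > R \<Longrightarrow> v \<zeta> = 0"
  shows "integrable lborel (\<lambda>\<zeta>. v \<zeta> / (z - \<zeta>))"
proof (rule Bochner_Integration.integrable_bound)
  \<comment> \<open>With this radius |z - \<zeta>| \<le> ?r on the whole support, so 1 / |z -
    \<zeta>| is dominated by the integrable kernel there.\<close>
  let ?r = "\<bar>R\<bar> + norm z + 1"
  show "integrable lborel (\<lambda>\<zeta>. M * (2 * decay_kernel ?r (z - \<zeta>)))"
    by (intro integrable_mult_right decay_kernel_integrable_lborel) (auto intro: add_nonneg_pos)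
  show "AE \<zeta> in lborel. norm (v \<zeta> / (z - \<zeta>)) \<le> norm (M * (2 * decay_kernel ?r (z - \<zeta>)))"
  proof (intro AE_I2)
    fix \<zeta>
    have M0: "M \<ge> 0" using M[of 0] norm_ge_zero order_trans by blast
    show "norm (v \<zeta> / (z - \<zeta>)) \<le> norm (M * (2 * decay_kernel ?r (z - \<zeta>)))"
    proof (cases "norm \<zeta> > R")
      case False
      then have "norm (z - \<zeta>) \<le> ?r" using norm_triangle_ineq4[of z \<zeta>] by linarith
      moreover have "?r > 0" by (smt (verit) norm_ge_zero abs_ge_zero)
      ultimately have "1 / norm (z - \<zeta>) \<le> 2 * decay_kernel ?r (z - \<zeta>)" by (intro inverse_le_kernel)
      then have "norm (v \<zeta>) * (1 / norm (z - \<zeta>)) \<le> M * (2 * decay_kernel ?r (z - \<zeta>))"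
        using M[of \<zeta>] M0 by (intro mult_mono) auto
      then show ?thesis by (simp add: norm_divide)
    qed (simp add: supp)
  qed
qed measurable

text \<open>Fubini, then the translation of \<zeta> by a point of the segment, then Fubini again:
  this moves the displacement from \<open>f\<close> to the Cauchy kernel. The resulting
  \<open>D\<close> is the integral of 1 / (w - (\<zeta> - z)) along the fixed segment from
  \<open>a\<close> to \<open>b\<close>.\<close>

lemma line_integral_cauchy_transform:
  fixes f :: "complex \<Rightarrow> complex" and a b z :: complex
  assumes f: "continuous_on UNIV f" and supp: "\<And>\<zeta>. norm \<zeta> > R \<Longrightarrow> f \<zeta> = 0"
    and M: "\<And>\<zeta>. norm (f \<zeta>) \<le> M"
  defines "D \<equiv> (\<lambda>\<zeta>. \<integral>t. indicator {0..1} t *\<^sub>R ((b - a) * (1 / (linepath a b t - (\<zeta> - z)))) \<partial>lborel)"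
  shows "(\<integral>\<zeta>. contour_integral (linepath (\<zeta> + a) (\<zeta> + b)) f / (z - \<zeta>) \<partial>lborel) = (\<integral>\<zeta>. f \<zeta> * D \<zeta> \<partial>lborel)"
    and "integrable lborel (\<lambda>\<zeta>. f \<zeta> * D \<zeta>)"
    and "(\<lambda>\<zeta>. contour_integral (linepath (\<zeta> + a) (\<zeta> + b)) f) \<in> borel_measurable borel"
    and "integrable lborel (\<lambda>\<zeta>. contour_integral (linepath (\<zeta> + a) (\<zeta> + b)) f / (z - \<zeta>))"
proof -
  have [measurable]: "f \<in> borel_measurable borel"
    using f by (rule borel_measurable_continuous_onI)
  have [measurable]: "linepath a b \<in> borel_measurable borel"
    by (intro borel_measurable_continuous_onI continuous_intros)
  let ?p = "linepath a b"
  let ?I = "\<lambda>t::real. indicator {0..1} t :: real"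
  define H where "H = (\<lambda>t \<zeta>. ?I t *\<^sub>R ((b - a) * f (\<zeta> + ?p t)) / (z - \<zeta>))"
  define H2 where "H2 = (\<lambda>t \<zeta>. ?I t *\<^sub>R ((b - a) * f \<zeta>) / (z - (\<zeta> - ?p t)))"
  have [measurable]: "case_prod H \<in> borel_measurable (lborel \<Otimes>\<^sub>M lborel)"
    unfolding H_def by measurable
  have [measurable]: "case_prod H2 \<in> borel_measurable (lborel \<Otimes>\<^sub>M lborel)"
    unfolding H2_def by measurable
  \<comment> \<open>Beyond this radius \<zeta> + p t has norm above \<open>R\<close> for every point
    p t of the segment, so one majorant \<open>B\<close>, independent of t, dominates all slices of
    \<open>H\<close>. The absolute value covers a negative \<open>R\<close>.\<close>
  define R' where "R' = \<bar>R\<bar> + norm a + norm b"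
  define N where "N = norm (b - a) * M"
  have M0: "M \<ge> 0" using M[of 0] norm_ge_zero order_trans by blast
  define B where "B = (\<lambda>\<zeta>. if norm \<zeta> \<le> R' then complex_of_real N / (z - \<zeta>) else 0)"
  have B: "integrable lborel B"
  proof -
    have "integrable lborel (\<lambda>\<zeta>. (if norm \<zeta> \<le> R' then complex_of_real N else 0) / (z - \<zeta>))"
      using M0 by (intro cauchy_transform_integrable[where M = N and R = R']) (auto simp: N_def norm_mult)
    also have "(\<lambda>\<zeta>. (if norm \<zeta> \<le> R' then complex_of_real N else 0) / (z - \<zeta>)) = B"
      by (auto simp: B_def)
    finally show ?thesis .
  qed
  have HB: "norm (H t \<zeta>) \<le> ?I t * norm (B \<zeta>)" for t \<zeta>
  proof (cases "t \<in> {0..1}")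
    case True
    have "?p t \<in> closed_segment a b" using True by (simp add: linepath_in_path)
    then have p: "norm (?p t) \<le> norm a + norm b"
      using True norm_triangle_ineq[of "(1 - t) *\<^sub>R a" "t *\<^sub>R b"]
        mult_left_le_one_le[of "norm a" "1 - t"] mult_left_le_one_le[of "norm b" t]
      by (simp add: linepath_def)
    show ?thesis
    proof (cases "norm \<zeta> \<le> R'")
      case True
      have "norm (b - a) * norm (f (\<zeta> + ?p t)) \<le> N" unfolding N_def by (intro mult_left_mono M) auto
      then show ?thesis using True M0
        by (auto simp: H_def B_def norm_divide norm_mult indicator_def divide_right_mono N_def)
    next
      case False
      then have "norm (\<zeta> + ?p t) > R" using p norm_diff_ineq[of \<zeta> "?p t"] unfolding R'_def by linarith
      then show ?thesis by (simp add: H_def supp)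
    qed
  qed (simp add: H_def)
  have inH: "integrable lborel (H t)" for t
    by (rule Bochner_Integration.integrable_bound[OF integrable_mult_right[OF integrable_norm[OF B], of "?I t"]])
       (use HB[of t] in \<open>auto simp: H_def\<close>)
  have intH: "integrable (lborel \<Otimes>\<^sub>M lborel) (case_prod H)"
  proof (rule lborel_pair.Fubini_integrable)
    show "integrable lborel (\<lambda>t. \<integral>\<zeta>. norm (case_prod H (t, \<zeta>)) \<partial>lborel)"
    proof (rule Bochner_Integration.integrable_bound[of _ "\<lambda>t. ?I t * (\<integral>\<zeta>. norm (B \<zeta>) \<partial>lborel)"])
      show "integrable lborel (\<lambda>t. ?I t * (\<integral>\<zeta>. norm (B \<zeta>) \<partial>lborel))"
        by (intro integrable_mult_left) simp
      show "AE t in lborel. norm (\<integral>\<zeta>. norm (case_prod H (t, \<zeta>)) \<partial>lborel) \<le> norm (?I t * (\<integral>\<zeta>. norm (B \<zeta>) \<partial>lborel))"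
      proof (intro AE_I2)
        fix t
        have "(\<integral>\<zeta>. norm (H t \<zeta>) \<partial>lborel) \<le> (\<integral>\<zeta>. ?I t * norm (B \<zeta>) \<partial>lborel)"
          by (intro integral_mono integrable_norm inH integrable_mult_right B HB)
        then show "norm (\<integral>\<zeta>. norm (case_prod H (t, \<zeta>)) \<partial>lborel) \<le> norm (?I t * (\<integral>\<zeta>. norm (B \<zeta>) \<partial>lborel))"
          by (simp add: abs_mult)
      qed
    qed measurable
  qed (auto simp: inH)
  \<comment> \<open>By translation invariance the slices of \<open>H2\<close> have the same
    integrals and norm integrals as those of \<open>H\<close>, so integrability on the product
    carries over.\<close>
  have shift: "H2 t (?p t + \<zeta>) = H t \<zeta>" for t \<zeta> by (simp add: H_def H2_def add.commute)
  have intH2: "integrable (lborel \<Otimes>\<^sub>M lborel) (case_prod H2)"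
  proof (rule lborel_pair.Fubini_integrable)
    have "(\<integral>\<zeta>. norm (H2 t \<zeta>) \<partial>lborel) = (\<integral>\<zeta>. norm (H t \<zeta>) \<partial>lborel)" for t
      by (subst lborel_translation(1)[of _ "?p t"]) (auto simp: shift) 
    then show "integrable lborel (\<lambda>t. \<integral>\<zeta>. norm (case_prod H2 (t, \<zeta>)) \<partial>lborel)"
      using lborel_pair.integrable_fst'[OF integrable_norm[OF intH]] by simp
    have "integrable lborel (H2 t)" for t
      by (subst lborel_translation(2)[of _ "?p t"]) (auto simp: shift inH)
    then show "AE t in lborel. integrable lborel (\<lambda>\<zeta>. case_prod H2 (t, \<zeta>))" by simp
  qed measurable
  have L: "contour_integral (linepath (\<zeta> + a) (\<zeta> + b)) f
     = (\<integral>t. ?I t *\<^sub>R ((b - a) * f (\<zeta> + ?p t)) \<partial>lborel)" for \<zeta>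
  proof -
    have "linepath (\<zeta> + a) (\<zeta> + b) t = \<zeta> + ?p t" for t
      by (simp add: linepath_def algebra_simps)
    then show ?thesis
      using contour_integral_linepath_lborel[of "\<zeta> + a" "\<zeta> + b" f] continuous_on_subset[OF f] by simp
  qed
  show "(\<lambda>\<zeta>. contour_integral (linepath (\<zeta> + a) (\<zeta> + b)) f) \<in> borel_measurable borel"
    unfolding L by measurable
  have eq1: "contour_integral (linepath (\<zeta> + a) (\<zeta> + b)) f / (z - \<zeta>) = (\<integral>t. H t \<zeta> \<partial>lborel)" for \<zeta>
    unfolding L H_def by simp
  have eq2: "f \<zeta> * D \<zeta> = (\<integral>t. H2 t \<zeta> \<partial>lborel)" for \<zeta>
    unfolding D_def H2_def by (subst integral_mult_right_zero[symmetric]) (auto intro!: Bochner_Integration.integral_cong simp: indicator_def algebra_simps)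
  have "(\<integral>\<zeta>. (\<integral>t. H t \<zeta> \<partial>lborel) \<partial>lborel) = (\<integral>t. (\<integral>\<zeta>. H t \<zeta> \<partial>lborel) \<partial>lborel)"
    by (rule lborel_pair.Fubini_integral[OF intH])
  also have "\<dots> = (\<integral>t. (\<integral>\<zeta>. H2 t \<zeta> \<partial>lborel) \<partial>lborel)"
  proof (rule Bochner_Integration.integral_cong[OF refl])
    fix t
    show "(\<integral>\<zeta>. H t \<zeta> \<partial>lborel) = (\<integral>\<zeta>. H2 t \<zeta> \<partial>lborel)"
      by (subst lborel_translation(1)[of "H2 t" "?p t"]) (auto simp: shift)
  qed
  also have "\<dots> = (\<integral>\<zeta>. (\<integral>t. H2 t \<zeta> \<partial>lborel) \<partial>lborel)"
    by (rule lborel_pair.Fubini_integral[OF intH2, symmetric])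
  finally show "(\<integral>\<zeta>. contour_integral (linepath (\<zeta> + a) (\<zeta> + b)) f / (z - \<zeta>) \<partial>lborel) = (\<integral>\<zeta>. f \<zeta> * D \<zeta> \<partial>lborel)"
    unfolding eq1 eq2 .
  show "integrable lborel (\<lambda>\<zeta>. f \<zeta> * D \<zeta>)"
    unfolding eq2 using lborel_pair.integrable_snd[OF intH2] by simp
  show "integrable lborel (\<lambda>\<zeta>. contour_integral (linepath (\<zeta> + a) (\<zeta> + b)) f / (z - \<zeta>))"
    unfolding eq1 using lborel_pair.integrable_snd[OF intH] by simp
qed

section \<open>Contour integrals around squares\<close>

lemma contour_integral_rectpath_linepaths:
  assumes f: "continuous_on (path_image (rectpath a c)) f"
  defines "b \<equiv> Complex (Re c) (Im a)" and "d \<equiv> Complex (Re a) (Im c)"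
  shows "contour_integral (rectpath a c) f = contour_integral (linepath a b) f + contour_integral (linepath b c) f
     + contour_integral (linepath c d) f + contour_integral (linepath d a) f"
proof -
  have i: "f contour_integrable_on linepath a b" "f contour_integrable_on linepath b c"
    "f contour_integrable_on linepath c d" "f contour_integrable_on linepath d a"
    by (intro contour_integrable_continuous_linepath continuous_on_subset[OF f];
        force simp: rectpath_def Let_def path_image_join b_def d_def)+
  then show ?thesis
    by (simp add: rectpath_def Let_def flip: b_def d_def)
qed

text \<open>For smooth \<open>f\<close>, Green's theorem makes this 2 i times the integral of the
  d-bar derivative of \<open>f\<close> over the square of half side \<open>h\<close>. As a contour
  integral it makes sense for continuous \<open>f\<close>.\<close>

definition square_contour_integral :: "real \<Rightarrow> (complex \<Rightarrow> complex) \<Rightarrow> complex \<Rightarrow> complex" where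
  "square_contour_integral h f \<zeta> = contour_integral (rectpath (\<zeta> - Complex h h) (\<zeta> + Complex h h)) f"

lemma path_image_square_subset:
  "h > 0 \<Longrightarrow> path_image (rectpath (\<zeta> - Complex h h) (\<zeta> + Complex h h)) \<subseteq> cbox (\<zeta> - Complex h h) (\<zeta> + Complex h h)"
  by (intro path_image_rectpath_subset_cbox) auto

lemma square_subset_cball:
  assumes "h > 0" shows "cbox (\<zeta> - Complex h h) (\<zeta> + Complex h h) \<subseteq> cball \<zeta> (2 * h)"
proof
  fix w assume "w \<in> cbox (\<zeta> - Complex h h) (\<zeta> + Complex h h)"
  then have "\<bar>Re (w - \<zeta>)\<bar> \<le> h" "\<bar>Im (w - \<zeta>)\<bar> \<le> h" by (auto simp: in_cbox_complex_iff)
  then have "norm (w - \<zeta>) \<le> 2 * h" using cmod_le[of "w - \<zeta>"] by linarith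
  then show "w \<in> cball \<zeta> (2 * h)" by (simp add: dist_norm norm_minus_commute)
qed

lemma square_contour_integral_eq_0:
  assumes "h > 0" "f holomorphic_on S" "cbox (\<zeta> - Complex h h) (\<zeta> + Complex h h) \<subseteq> S"
  shows "square_contour_integral h f \<zeta> = 0"
  unfolding square_contour_integral_def
  by (intro contour_integral_unique Cauchy_theorem_convex_simple[of f "cbox (\<zeta> - Complex h h) (\<zeta> + Complex h h)"]
        path_image_square_subset holomorphic_on_subset[OF assms(2,3)]) (use assms in auto)

lemma square_contour_integral_linepaths:
  assumes "h > 0" "continuous_on UNIV f"
  shows "square_contour_integral h f \<zeta> =
     contour_integral (linepath (\<zeta> + Complex (-h) (-h)) (\<zeta> + Complex h (-h))) f
   + contour_integral (linepath (\<zeta> + Complex h (-h)) (\<zeta> + Complex h h)) f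
   + contour_integral (linepath (\<zeta> + Complex h h) (\<zeta> + Complex (-h) h)) f
   + contour_integral (linepath (\<zeta> + Complex (-h) h) (\<zeta> + Complex (-h) (-h))) f"
proof -
  have c: "\<zeta> - Complex h h = \<zeta> + Complex (-h) (-h)" "Complex (Re (\<zeta> + Complex h h)) (Im (\<zeta> - Complex h h)) = \<zeta> + Complex h (-h)"
     "Complex (Re (\<zeta> - Complex h h)) (Im (\<zeta> + Complex h h)) = \<zeta> + Complex (-h) h"
    by (auto simp: complex_eq_iff)
  show ?thesis
    unfolding square_contour_integral_def
      contour_integral_rectpath_linepaths[OF continuous_on_subset[OF assms(2) subset_UNIV]] c(2,3)
    unfolding c(1) ..
qed

text \<open>The constant \<open>f \<zeta>\<close> may be subtracted by Cauchy's theorem; then each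
  of the four sides, of length 2 h, contributes at most 2 h \<omega>.\<close>

lemma square_contour_integral_bound:
  assumes h: "h > 0" and f: "continuous_on UNIV f" and "0 \<le> \<omega>"
    and \<omega>: "\<And>w. w \<in> cball \<zeta> (2 * h) \<Longrightarrow> norm (f w - f \<zeta>) \<le> \<omega>"
  shows "norm (square_contour_integral h f \<zeta>) \<le> 8 * h * \<omega>"
proof -
  let ?g = "\<lambda>w. f w - f \<zeta>" and ?S = "cbox (\<zeta> - Complex h h) (\<zeta> + Complex h h)"
  have g: "continuous_on UNIV ?g" using f by (intro continuous_intros)
  have "square_contour_integral h f \<zeta> = square_contour_integral h ?g \<zeta> + square_contour_integral h (\<lambda>_. f \<zeta>) \<zeta>"
    unfolding square_contour_integral_linepaths[OF h f] square_contour_integral_linepaths[OF h g]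
      square_contour_integral_linepaths[OF h continuous_on_const]
    by (simp add: contour_integral_diff contour_integrable_continuous_linepath continuous_on_subset[OF f])
  also have "square_contour_integral h (\<lambda>_. f \<zeta>) \<zeta> = 0"
    by (rule square_contour_integral_eq_0[OF h, of _ UNIV]) auto
  finally have eq: "square_contour_integral h f \<zeta> = square_contour_integral h ?g \<zeta>" by simp
  have side: "norm (contour_integral (linepath a b) ?g) \<le> \<omega> * (2 * h)"
    if "a \<in> ?S" "b \<in> ?S" "norm (b - a) = 2 * h" for a b
  proof -
    have "closed_segment a b \<subseteq> ?S" using that by (intro closed_segment_subset) auto
    then have "norm (contour_integral (linepath a b) ?g) \<le> \<omega> * norm (b - a)"
      using \<open>0 \<le> \<omega>\<close> square_subset_cball[OF h, of \<zeta>]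
      by (intro contour_integral_bound_linepath contour_integrable_continuous_linepath continuous_on_subset[OF g] \<omega>) auto
    then show ?thesis using that by simp
  qed
  have tri: "norm (a1 + a2 + a3 + a4) \<le> 4 * (\<omega> * (2 * h))"
    if "norm a1 \<le> \<omega> * (2 * h)" "norm a2 \<le> \<omega> * (2 * h)" "norm a3 \<le> \<omega> * (2 * h)" "norm a4 \<le> \<omega> * (2 * h)" for a1 a2 a3 a4 :: complex
    using that norm_triangle_ineq[of "a1 + a2 + a3" a4] norm_triangle_ineq[of "a1 + a2" a3] norm_triangle_ineq[of a1 a2] by linarith
  have "norm (square_contour_integral h ?g \<zeta>) \<le> 4 * (\<omega> * (2 * h))"
    unfolding square_contour_integral_linepaths[OF h g]
    by (intro tri side) (use h in \<open>auto simp: in_cbox_complex_iff cmod_def real_sqrt_mult simp flip: mult_2\<close>)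
  then show ?thesis by (simp add: eq mult.commute mult.left_commute)
qed

lemma square_contour_integral_support:
  assumes "h > 0" and "\<And>\<zeta>. norm \<zeta> > R \<Longrightarrow> f \<zeta> = 0" and "norm \<zeta> > R + 2 * h"
  shows "square_contour_integral h f \<zeta> = 0"
proof (rule square_contour_integral_eq_0[OF assms(1) _ square_subset_cball[OF assms(1)]])
  have "f w = 0" if "w \<in> cball \<zeta> (2 * h)" for w
    using that assms(3) norm_triangle_ineq2[of \<zeta> w] by (intro assms(2)) (auto simp: dist_norm)
  then show "f holomorphic_on cball \<zeta> (2 * h)"
    by (metis (no_types, lifting) holomorphic_on_const holomorphic_transform)
qed

section \<open>The Cauchy transform of the square integral\<close>

lemma AE_not_in_square_boundary: "AE \<zeta>::complex in lborel. \<zeta> \<notin> cbox a b - box a b"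
proof -
  have "negligible (frontier (cbox a b))" by (intro negligible_convex_frontier convex_box)
  then have "cbox a b - box a b \<in> null_sets lebesgue"
    by (simp add: frontier_cbox negligible_iff_null_sets)
  then have "AE \<zeta> in lebesgue. \<zeta> \<notin> cbox a b - box a b" by (rule AE_not_in)
  then show ?thesis by (simp add: AE_completion_iff)
qed

text \<open>After the exchange on each side, the four factors \<open>D k\<close> add up to the
  integral of 1 / (w - (\<zeta> - z)) around the square centred at 0. This is 2 pi i times a winding
  number, which is 1 or 0 according to whether \<zeta> lies in the open square about
  \<open>z\<close>; the boundary is a null set.\<close>

lemma cauchy_transform_square_contour_integral:
  assumes h: "h > 0" and f: "continuous_on UNIV f" and supp: "\<And>\<zeta>. norm \<zeta> > R \<Longrightarrow> f \<zeta> = 0"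
    and M: "\<And>\<zeta>. norm (f \<zeta>) \<le> M"
  shows "(\<integral>\<zeta>. square_contour_integral h f \<zeta> / (z - \<zeta>) \<partial>lborel)
     = 2 * pi * \<i> * (\<integral>\<zeta>. indicator (box (z - Complex h h) (z + Complex h h)) \<zeta> *\<^sub>R f \<zeta> \<partial>lborel)"
    and "square_contour_integral h f \<in> borel_measurable borel"
proof -
  \<comment> \<open>The first corner is repeated at the end, so that side k always runs from
    \<open>p k\<close> to \<open>p (Suc k)\<close>.\<close>
  define p where "p = (\<lambda>k::nat. [Complex (-h) (-h), Complex h (-h), Complex h h, Complex (-h) h, Complex (-h) (-h)] ! k)"
  define C where "C = (\<lambda>k \<zeta>. contour_integral (linepath (\<zeta> + p k) (\<zeta> + p (Suc k))) f)"
  define D where "D = (\<lambda>k \<zeta>. \<integral>t. indicator {0..1} t *\<^sub>R ((p (Suc k) - p k) * (1 / (linepath (p k) (p (Suc k)) t - (\<zeta> - z)))) \<partial>lborel)"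
  have sc: "square_contour_integral h f \<zeta> = (\<Sum>k<4. C k \<zeta>)" for \<zeta>
    by (simp add: square_contour_integral_linepaths[OF h f] C_def p_def eval_nat_numeral)
  have L: "(\<integral>\<zeta>. C k \<zeta> / (z - \<zeta>) \<partial>lborel) = (\<integral>\<zeta>. f \<zeta> * D k \<zeta> \<partial>lborel)"
    "integrable lborel (\<lambda>\<zeta>. f \<zeta> * D k \<zeta>)" "integrable lborel (\<lambda>\<zeta>. C k \<zeta> / (z - \<zeta>))" for k
    unfolding C_def D_def by (rule line_integral_cauchy_transform[OF f supp M]; assumption)+
  have Cm: "C k \<in> borel_measurable borel" for k
    unfolding C_def by (rule line_integral_cauchy_transform(3)[OF f supp M])
  show "square_contour_integral h f \<in> borel_measurable borel"
    unfolding sc using Cm by measurable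
  have "(\<integral>\<zeta>. square_contour_integral h f \<zeta> / (z - \<zeta>) \<partial>lborel) = (\<Sum>k<4. \<integral>\<zeta>. C k \<zeta> / (z - \<zeta>) \<partial>lborel)"
    unfolding sc sum_divide_distrib by (intro Bochner_Integration.integral_sum L)
  also have "\<dots> = (\<Sum>k<4. \<integral>\<zeta>. f \<zeta> * D k \<zeta> \<partial>lborel)" by (simp add: L)
  also have "\<dots> = (\<integral>\<zeta>. (\<Sum>k<4. f \<zeta> * D k \<zeta>) \<partial>lborel)"
    by (intro Bochner_Integration.integral_sum[symmetric] L)
  also have "\<dots> = (\<integral>\<zeta>. 2 * pi * \<i> * (indicator (box (z - Complex h h) (z + Complex h h)) \<zeta> *\<^sub>R f \<zeta>) \<partial>lborel)"
  proof (rule integral_cong_AE)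
    have [measurable]: "f \<in> borel_measurable borel" using f by (rule borel_measurable_continuous_onI)
    show "(\<lambda>\<zeta>. \<Sum>k<4. f \<zeta> * D k \<zeta>) \<in> borel_measurable lborel"
      using borel_measurable_integrable[OF L(2)] by measurable
    show "(\<lambda>\<zeta>. 2 * pi * \<i> * (indicator (box (z - Complex h h) (z + Complex h h)) \<zeta> *\<^sub>R f \<zeta>)) \<in> borel_measurable lborel"
      by measurable
    show "AE \<zeta> in lborel. (\<Sum>k<4. f \<zeta> * D k \<zeta>)
       = 2 * pi * \<i> * (indicator (box (z - Complex h h) (z + Complex h h)) \<zeta> *\<^sub>R f \<zeta>)"
      using AE_not_in_square_boundary[of "z - Complex h h" "z + Complex h h"]
    proof eventually_elim
      fix \<zeta> assume \<zeta>: "\<zeta> \<notin> cbox (z - Complex h h) (z + Complex h h) - box (z - Complex h h) (z + Complex h h)"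
      define c where "c = \<zeta> - z"
      let ?g = "\<lambda>w. 1 / (w - c)" and ?r = "rectpath (- Complex h h) (Complex h h)"
      have c: "c \<notin> path_image ?r"
        using \<zeta> h by (auto simp: path_image_rectpath_cbox_minus_box in_cbox_complex_iff in_box_complex_iff c_def)
      then have cont: "continuous_on (path_image ?r) ?g" by (auto intro!: continuous_intros)
      have corner: "- Complex h h = Complex (-h) (-h)" "Complex (Re (Complex h h)) (Im (- Complex h h)) = Complex h (-h)"
        "Complex (Re (- Complex h h)) (Im (Complex h h)) = Complex (-h) h" by (auto simp: complex_eq_iff)
      have seg: "closed_segment (p k) (p (Suc k)) \<subseteq> path_image ?r" if "k < 4" for k
        using that unfolding rectpath_def Let_def corner
        by (auto simp: path_image_join p_def eval_nat_numeral less_Suc_eq corner)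
      have "D k \<zeta> = contour_integral (linepath (p k) (p (Suc k))) ?g" if "k < 4" for k
        unfolding D_def c_def[symmetric]
        by (rule contour_integral_linepath_lborel[symmetric]) (rule continuous_on_subset[OF cont seg[OF that]])
      then have "(\<Sum>k<4. D k \<zeta>) = (\<Sum>k<4. contour_integral (linepath (p k) (p (Suc k))) ?g)"
        by (intro sum.cong) auto
      also have "\<dots> = contour_integral ?r ?g"
        unfolding contour_integral_rectpath_linepaths[OF cont] unfolding corner(2,3) unfolding corner(1) by (simp add: p_def eval_nat_numeral)
      also have "\<dots> = 2 * pi * \<i> * winding_number ?r c"
        using winding_number_valid_path[OF valid_path_rectpath c] by simp
      also have "winding_number ?r c = indicator (box (z - Complex h h) (z + Complex h h)) \<zeta>"
      proof (cases "\<zeta> \<in> box (z - Complex h h) (z + Complex h h)")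
        case True
        then have "c \<in> box (- Complex h h) (Complex h h)" by (auto simp: in_box_complex_iff c_def)
        then show ?thesis using True by (simp add: winding_number_rectpath)
      next
        case False
        then have "c \<notin> cbox (- Complex h h) (Complex h h)" using \<zeta> by (auto simp: in_cbox_complex_iff c_def)
        then show ?thesis using False h by (simp add: winding_number_rectpath_outside)
      qed
      finally show "(\<Sum>k<4. f \<zeta> * D k \<zeta>) = 2 * pi * \<i> * (indicator (box (z - Complex h h) (z + Complex h h)) \<zeta> *\<^sub>R f \<zeta>)"
        by (simp add: sum_distrib_left[symmetric] indicator_def)
    qed
  qed
  also have "\<dots> = 2 * pi * \<i> * (\<integral>\<zeta>. indicator (box (z - Complex h h) (z + Complex h h)) \<zeta> *\<^sub>R f \<zeta> \<partial>lborel)"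
    by (rule integral_mult_right_zero)
  finally show "(\<integral>\<zeta>. square_contour_integral h f \<zeta> / (z - \<zeta>) \<partial>lborel)
     = 2 * pi * \<i> * (\<integral>\<zeta>. indicator (box (z - Complex h h) (z + Complex h h)) \<zeta> *\<^sub>R f \<zeta> \<partial>lborel)" .
qed

text \<open>The square has area 4 h^2, so division by 8 pi i h^2 = 2 pi i * 4 h^2 leaves the average
  of \<open>f\<close> over the square, which differs from \<open>f z\<close> by at most the
  oscillation.\<close>

lemma cauchy_transform_square_contour_integral_approx:
  assumes h: "h > 0" and f: "continuous_on UNIV f" and supp: "\<And>\<zeta>. norm \<zeta> > R \<Longrightarrow> f \<zeta> = 0"
    and M: "\<And>\<zeta>. norm (f \<zeta>) \<le> M"
    and \<omega>: "\<And>w. w \<in> cball z (2 * h) \<Longrightarrow> norm (f w - f z) \<le> \<omega>"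
  shows "norm ((\<integral>\<zeta>. square_contour_integral h f \<zeta> / (z - \<zeta>) \<partial>lborel) / (8 * pi * \<i> * h\<^sup>2) - f z) \<le> \<omega>"
proof -
  let ?B = "box (z - Complex h h) (z + Complex h h)"
  have [measurable]: "f \<in> borel_measurable borel" using f by (rule borel_measurable_continuous_onI)
  have em: "emeasure lborel ?B = ennreal (4 * h\<^sup>2)"
    using h by (subst emeasure_lborel_box) (auto simp: Basis_complex_def power2_eq_square)
  then have m: "measure lborel ?B = 4 * h\<^sup>2" by (simp add: measure_def)
  have fin: "emeasure lborel ?B < \<infinity>" using em by simp
  have indi: "integrable lborel (indicator ?B :: complex \<Rightarrow> real)"
    using fin by (intro integrable_real_indicator) auto
  have M0: "M \<ge> 0" using M[of 0] norm_ge_zero order_trans by blast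
  have int1: "integrable lborel (\<lambda>\<zeta>. indicator ?B \<zeta> *\<^sub>R f \<zeta>)"
    by (rule Bochner_Integration.integrable_bound[OF integrable_mult_left[OF indi, of M]])
       (use M M0 in \<open>auto simp: indicator_def\<close>)
  have int2: "integrable lborel (\<lambda>\<zeta>. indicator ?B \<zeta> *\<^sub>R f z)"
    using indi by (intro integrable_scaleR_left)
  have "0 \<le> \<omega>" using \<omega>[of z] h by simp
  have "(\<integral>\<zeta>. indicator ?B \<zeta> *\<^sub>R f \<zeta> \<partial>lborel) - 4 * h\<^sup>2 * f z
      = (\<integral>\<zeta>. indicator ?B \<zeta> *\<^sub>R f \<zeta> - indicator ?B \<zeta> *\<^sub>R f z \<partial>lborel)"
    using fin by (subst Bochner_Integration.integral_diff[OF int1 int2]) (simp add: m scaleR_conv_of_real)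
  also have "norm \<dots> \<le> (\<integral>\<zeta>. indicator ?B \<zeta> * \<omega> \<partial>lborel)"
  proof (rule Bochner_Integration.integral_norm_bound_integral)
    show "integrable lborel (\<lambda>\<zeta>. indicator ?B \<zeta> * \<omega>)"
      using indi by (intro integrable_mult_left)
    fix \<zeta>
    have "?B \<subseteq> cball z (2 * h)" using square_subset_cball[OF h, of z] box_subset_cbox by blast
    then show "norm (indicator ?B \<zeta> *\<^sub>R f \<zeta> - indicator ?B \<zeta> *\<^sub>R f z) \<le> indicator ?B \<zeta> * \<omega>"
      using \<omega>[of \<zeta>] by (auto simp: indicator_def)
  qed (use int1 int2 in auto)
  also have "\<dots> = 4 * h\<^sup>2 * \<omega>" using m by simp
  finally have *: "norm ((\<integral>\<zeta>. indicator ?B \<zeta> *\<^sub>R f \<zeta> \<partial>lborel) - 4 * h\<^sup>2 * f z) \<le> 4 * h\<^sup>2 * \<omega>" .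
  have e: "(\<integral>\<zeta>. square_contour_integral h f \<zeta> / (z - \<zeta>) \<partial>lborel)
      = 2 * pi * \<i> * (\<integral>\<zeta>. indicator ?B \<zeta> *\<^sub>R f \<zeta> \<partial>lborel)"
    by (rule cauchy_transform_square_contour_integral(1)[OF h f supp M])
  have "(\<integral>\<zeta>. square_contour_integral h f \<zeta> / (z - \<zeta>) \<partial>lborel) / (8 * pi * \<i> * h\<^sup>2) - f z
     = ((\<integral>\<zeta>. indicator ?B \<zeta> *\<^sub>R f \<zeta> \<partial>lborel) - 4 * h\<^sup>2 * f z) / (4 * h\<^sup>2)"
    unfolding e using h by (simp add: field_simps)
  also have "norm \<dots> \<le> \<omega>" using * h by (simp add: norm_divide norm_mult norm_power field_simps)
  finally show ?thesis by simp
qed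

subsection \<open>Uniform limits of polynomials\<close>

text \<open>The algebra usually called P(K), in epsilon form; sequences of polynomials are extracted
  only in the final theorem.\<close>

definition polynomially_approximable :: "complex set \<Rightarrow> (complex \<Rightarrow> complex) set" where
  "polynomially_approximable K = {f. \<forall>\<epsilon>>0. \<exists>p. \<forall>z\<in>K. norm (f z - poly p z) < \<epsilon>}"

lemma polynomially_approximable_poly: "poly p \<in> polynomially_approximable K"
  unfolding polynomially_approximable_def by (intro CollectI allI impI exI[of _ p]) simp

lemma polynomially_approximable_const: "(\<lambda>_. c) \<in> polynomially_approximable K"
  using polynomially_approximable_poly[of "[:c:]"] by (simp add: polynomially_approximable_def)

lemma polynomially_approximable_id: "(\<lambda>z. z) \<in> polynomially_approximable K"
  using polynomially_approximable_poly[of "[:0, 1:]"] by (simp add: polynomially_approximable_def)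

lemma polynomially_approximable_cong:
  "(\<And>z. z \<in> K \<Longrightarrow> f z = g z) \<Longrightarrow> f \<in> polynomially_approximable K \<longleftrightarrow> g \<in> polynomially_approximable K"
  by (simp add: polynomially_approximable_def)

lemma polynomially_approximable_add:
  assumes f: "f \<in> polynomially_approximable K" and g: "g \<in> polynomially_approximable K"
  shows "(\<lambda>z. f z + g z) \<in> polynomially_approximable K"
  unfolding polynomially_approximable_def
proof (intro CollectI allI impI)
  fix \<epsilon> :: real assume "\<epsilon> > 0"
  then have "\<epsilon> / 2 > 0" by simp
  then obtain p q where pq: "\<forall>z\<in>K. norm (f z - poly p z) < \<epsilon> / 2" "\<forall>z\<in>K. norm (g z - poly q z) < \<epsilon> / 2"
    using f g unfolding polynomially_approximable_def by blast
  have "norm (f z + g z - poly (p + q) z) < \<epsilon>" if "z \<in> K" for z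
  proof -
    have eq: "f z + g z - poly (p + q) z = (f z - poly p z) + (g z - poly q z)" by simp
    have "norm (f z - poly p z) < \<epsilon> / 2" "norm (g z - poly q z) < \<epsilon> / 2" using pq that by auto
    then show ?thesis
      unfolding eq using norm_triangle_ineq[of "f z - poly p z" "g z - poly q z"] by linarith
  qed
  then show "\<exists>p. \<forall>z\<in>K. norm (f z + g z - poly p z) < \<epsilon>" by blast
qed

lemma polynomially_approximable_bounded:
  assumes K: "compact K" and f: "f \<in> polynomially_approximable K"
  obtains B where "B > 0" "\<And>z. z \<in> K \<Longrightarrow> norm (f z) \<le> B"
proof -
  obtain p where p: "\<forall>z\<in>K. norm (f z - poly p z) < 1"
    using f zero_less_one[where 'a = real] unfolding polynomially_approximable_def by blast
  have "bounded (poly p ` K)"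
    by (intro compact_imp_bounded compact_continuous_image continuous_intros K)
  then obtain B where B: "B > 0" "\<And>z. z \<in> K \<Longrightarrow> norm (poly p z) \<le> B" by (auto simp: bounded_pos)
  have "norm (f z) \<le> B + 1" if "z \<in> K" for z
    using norm_triangle_sub[of "f z" "poly p z"] bspec[OF p that] B(2)[OF that] by linarith
  then show ?thesis using that[of "B + 1"] B by simp
qed

lemma polynomially_approximable_mult:
  assumes K: "compact K" and f: "f \<in> polynomially_approximable K" and g: "g \<in> polynomially_approximable K"
  shows "(\<lambda>z. f z * g z) \<in> polynomially_approximable K"
  unfolding polynomially_approximable_def
proof (intro CollectI allI impI)
  fix \<epsilon> :: real assume \<epsilon>: "\<epsilon> > 0"
  \<comment> \<open>The order of choices matters: a bound for \<open>f\<close> determines the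
    accuracy of \<open>q\<close>, and only the bound \<open>C\<close> for the chosen
    \<open>q\<close> determines that of \<open>p\<close>.\<close>
  obtain B where B: "B > 0" "\<And>z. z \<in> K \<Longrightarrow> norm (f z) \<le> B"
    by (rule polynomially_approximable_bounded[OF K f], rule that)
  have "\<epsilon> / (2 * B) > 0" using \<epsilon> B by simp
  then obtain q where q: "\<forall>z\<in>K. norm (g z - poly q z) < \<epsilon> / (2 * B)"
    using g unfolding polynomially_approximable_def by blast
  obtain C where C: "C > 0" "\<And>z. z \<in> K \<Longrightarrow> norm (poly q z) \<le> C"
    by (rule polynomially_approximable_bounded[OF K polynomially_approximable_poly], rule that)
  have "\<epsilon> / (2 * C) > 0" using \<epsilon> C by simp
  then obtain p where p: "\<forall>z\<in>K. norm (f z - poly p z) < \<epsilon> / (2 * C)"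
    using f unfolding polynomially_approximable_def by blast
  have "norm (f z * g z - poly (p * q) z) < \<epsilon>" if z: "z \<in> K" for z
  proof -
    have eq: "f z * g z - poly (p * q) z = f z * (g z - poly q z) + (f z - poly p z) * poly q z"
      by (simp add: algebra_simps)
    have "norm (f z * (g z - poly q z)) \<le> B * norm (g z - poly q z)"
      unfolding norm_mult using B z by (intro mult_right_mono) auto
    also have "\<dots> < B * (\<epsilon> / (2 * B))" using q z B by (intro mult_strict_left_mono) auto
    finally have 1: "norm (f z * (g z - poly q z)) < \<epsilon> / 2" using B by simp
    have "norm ((f z - poly p z) * poly q z) \<le> norm (f z - poly p z) * C"
      unfolding norm_mult using C z by (intro mult_left_mono) auto
    also have "\<dots> < \<epsilon> / (2 * C) * C" using p z C by (intro mult_strict_right_mono) auto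
    finally have "norm ((f z - poly p z) * poly q z) < \<epsilon> / 2" using C by simp
    with 1 show ?thesis unfolding eq
      using norm_triangle_ineq[of "f z * (g z - poly q z)" "(f z - poly p z) * poly q z"] by linarith
  qed
  then show "\<exists>p. \<forall>z\<in>K. norm (f z * g z - poly p z) < \<epsilon>" by blast
qed

lemma polynomially_approximable_sum:
  assumes "finite J" "\<And>j. j \<in> J \<Longrightarrow> f j \<in> polynomially_approximable K"
  shows "(\<lambda>z. \<Sum>j\<in>J. f j z) \<in> polynomially_approximable K"
  using assms
  by (induction J rule: finite_induct) (auto intro: polynomially_approximable_const polynomially_approximable_add)

lemma polynomially_approximable_power:
  assumes "compact K" "f \<in> polynomially_approximable K"
  shows "(\<lambda>z. f z ^ n) \<in> polynomially_approximable K"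
  by (induction n) (auto intro: polynomially_approximable_const polynomially_approximable_mult assms)

lemma polynomially_approximable_closed:
  assumes "\<And>\<epsilon>. \<epsilon> > 0 \<Longrightarrow> \<exists>g\<in>polynomially_approximable K. \<forall>z\<in>K. norm (f z - g z) < \<epsilon>"
  shows "f \<in> polynomially_approximable K"
  unfolding polynomially_approximable_def
proof (intro CollectI allI impI)
  fix \<epsilon> :: real assume "\<epsilon> > 0"
  then obtain g where g: "g \<in> polynomially_approximable K" "\<forall>z\<in>K. norm (f z - g z) < \<epsilon> / 2"
    using assms[of "\<epsilon> / 2"] by auto
  then obtain p where p: "\<forall>z\<in>K. norm (g z - poly p z) < \<epsilon> / 2"
    using half_gt_zero[OF \<open>\<epsilon> > 0\<close>] unfolding polynomially_approximable_def by blast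
  have "norm (f z - poly p z) < \<epsilon>" if "z \<in> K" for z
  proof -
    have "norm (f z - g z) < \<epsilon> / 2" "norm (g z - poly p z) < \<epsilon> / 2" using g(2) p that by auto
    then show ?thesis using norm_triangle_ineq[of "f z - g z" "g z - poly p z"] by simp
  qed
  then show "\<exists>p. \<forall>z\<in>K. norm (f z - poly p z) < \<epsilon>" by blast
qed

section \<open>Geometric series and the moving of poles\<close>

text \<open>The partial sums of the geometric series in \<open>f\<close> converge uniformly, with
  error at most c^n / (1 - c).\<close>

lemma polynomially_approximable_neumann:
  assumes K: "compact K" and f: "f \<in> polynomially_approximable K"
    and c: "c < 1" "\<And>z. z \<in> K \<Longrightarrow> norm (f z) \<le> c"
  shows "(\<lambda>z. 1 / (1 - f z)) \<in> polynomially_approximable K"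
proof (rule polynomially_approximable_closed)
  fix \<epsilon> :: real assume \<epsilon>: "\<epsilon> > 0"
  show "\<exists>g\<in>polynomially_approximable K. \<forall>z\<in>K. norm (1 / (1 - f z) - g z) < \<epsilon>"
  proof (cases "K = {}")
    case False
    then have c0: "c \<ge> 0" using c(2) norm_ge_zero order_trans by blast
    have "(\<lambda>n. c ^ n / (1 - c)) \<longlonglongrightarrow> 0 / (1 - c)"
      using c(1) c0 by (intro tendsto_intros LIMSEQ_realpow_zero) auto
    then have "\<forall>\<^sub>F n in sequentially. c ^ n / (1 - c) < \<epsilon>" using \<epsilon> by (intro order_tendstoD(2)) auto
    then obtain n where n: "c ^ n / (1 - c) < \<epsilon>" by (auto simp: eventually_sequentially)
    have est: "norm (1 / (1 - f z) - (\<Sum>k<n. f z ^ k)) < \<epsilon>" if z: "z \<in> K" for z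
    proof -
      have ne: "f z \<noteq> 1" using c(1) c(2)[OF z] by auto
      have "1 / (1 - f z) - (\<Sum>k<n. f z ^ k) = f z ^ n / (1 - f z)"
        using ne by (simp add: sum_gp_strict field_simps)
      also have "norm \<dots> \<le> c ^ n / (1 - c)"
        unfolding norm_divide norm_power
        using c(1) c(2)[OF z] norm_triangle_ineq2[of 1 "f z"] c0 by (intro frac_le power_mono) auto
      finally show ?thesis using n by simp
    qed
    have mem: "(\<lambda>z. \<Sum>k<n. f z ^ k) \<in> polynomially_approximable K"
      by (intro polynomially_approximable_sum polynomially_approximable_power K f) auto
    show ?thesis by (intro bexI[OF _ mem] ballI est)
  qed (use polynomially_approximable_const[of 0 K] in auto)
qed

text \<open>1 / (z - v) is 1 / (z - w) times the sum of the geometric series in (v - w) / (z - w), a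
  ratio of norm at most 1/2 on \<open>K\<close>.\<close>

lemma polynomially_approximable_pole_step:
  assumes K: "compact K" and w: "(\<lambda>z. 1 / (z - w)) \<in> polynomially_approximable K"
    and d: "\<And>z. z \<in> K \<Longrightarrow> d \<le> norm (z - w)" and v: "2 * norm (v - w) < d"
  shows "(\<lambda>z. 1 / (z - v)) \<in> polynomially_approximable K"
proof -
  have d0: "d > 0" using v norm_ge_zero[of "v - w"] by linarith
  have f: "(\<lambda>z. (v - w) * (1 / (z - w))) \<in> polynomially_approximable K"
    by (intro polynomially_approximable_mult K w polynomially_approximable_const)
  have "norm ((v - w) * (1 / (z - w))) \<le> 1 / 2" if "z \<in> K" for z
  proof -
    have "norm (z - w) > 0" using d[OF that] d0 by linarith
    then show ?thesis using d[OF that] v by (simp add: norm_mult norm_divide field_simps)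
  qed
  from polynomially_approximable_neumann[OF K f _ this]
  have "(\<lambda>z. 1 / (1 - (v - w) * (1 / (z - w)))) \<in> polynomially_approximable K" by simp
  then have "(\<lambda>z. 1 / (z - w) * (1 / (1 - (v - w) * (1 / (z - w))))) \<in> polynomially_approximable K"
    by (intro polynomially_approximable_mult K w)
  moreover have "1 / (z - w) * (1 / (1 - (v - w) * (1 / (z - w)))) = 1 / (z - v)" if "z \<in> K" for z
  proof -
    have "z \<noteq> w" using d[OF that] d0 by auto
    then have "(z - w) * (1 - (v - w) * (1 / (z - w))) = z - v" by (simp add: field_simps)
    then show ?thesis by (simp only: times_divide_times_eq mult_1)
  qed
  ultimately show ?thesis using polynomially_approximable_cong by (metis (no_types, lifting))
qed

text \<open>The admissible poles form a subset of the connected complement that is relatively open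
  and closed by the pole step, and nonempty because a pole far away is admissible.\<close>

lemma polynomially_approximable_pole:
  assumes K: "compact K" and con: "connected (- K)" and w: "w \<notin> K"
  shows "(\<lambda>z. 1 / (z - w)) \<in> polynomially_approximable K"
proof (cases "K = {}")
  case False
  define P where "P = {v \<in> - K. (\<lambda>z. 1 / (z - v)) \<in> polynomially_approximable K}"
  have dist: "infdist v K \<le> norm (z - v)" if "z \<in> K" for z v
    using infdist_le[OF that, of v] by (simp add: dist_norm norm_minus_commute)
  have pos: "infdist v K > 0" if "v \<notin> K" for v
    using that False K by (simp add: compact_imp_closed infdist_pos_not_in_closed)
  have step: "v \<in> P" if "u \<in> P" "v \<notin> K" "2 * dist v u < infdist u K" for u v
    using polynomially_approximable_pole_step[OF K, of u "infdist u K" v] that dist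
    by (auto simp: P_def dist_norm)
  have "openin (top_of_set (- K)) P"
    unfolding openin_contains_ball
  proof (intro conjI ballI)
    fix u assume u: "u \<in> P"
    then have "infdist u K > 0" by (intro pos) (auto simp: P_def)
    moreover have "ball u (infdist u K / 2) \<inter> - K \<subseteq> P"
      using step[OF u] by (auto simp: dist_commute)
    ultimately show "\<exists>e>0. ball u e \<inter> - K \<subseteq> P" by (intro exI[of _ "infdist u K / 2"]) auto
  qed (auto simp: P_def)
  moreover have "closedin (top_of_set (- K)) P"
    unfolding closedin_limpt
  proof (intro conjI allI impI)
    fix v assume v: "v islimpt P \<and> v \<in> - K"
    then have d: "infdist v K > 0" by (intro pos) auto
    \<comment> \<open>With a quarter of the distance, u keeps at least 3/4 of the distance of v to
      \<open>K\<close>, which exceeds twice the distance of u and v, as the step requires.\<close>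
    then obtain u where u: "u \<in> P" "dist u v < infdist v K / 4"
      using v unfolding islimpt_approachable by (metis zero_less_divide_iff zero_less_numeral)
    have "infdist v K \<le> infdist u K + dist v u" by (rule infdist_triangle)
    then have "2 * dist v u < infdist u K" using u(2) d by (simp add: dist_commute)
    then show "v \<in> P" using step[OF u(1)] v by auto
  qed (auto simp: P_def)
  moreover have "P \<noteq> {}"
  proof -
    obtain B where B: "B > 0" "\<And>z. z \<in> K \<Longrightarrow> norm z \<le> B"
      using K by (metis compact_imp_bounded bounded_pos)
    \<comment> \<open>This makes |z / v| \<le> 1/2 on \<open>K\<close>, so the geometric series
      applies to 1 / (z - v) = (- 1 / v) / (1 - z / v).\<close>
    define v where "v = complex_of_real (2 * B)"
    have vK: "v \<notin> K" using B(2)[of v] B(1) by (auto simp: v_def norm_mult)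
    have v0: "v \<noteq> 0" using B by (simp add: v_def)
    have f: "(\<lambda>z. (1 / v) * z) \<in> polynomially_approximable K"
      by (intro polynomially_approximable_mult polynomially_approximable_const polynomially_approximable_id K)
    have "norm ((1 / v) * z) \<le> 1 / 2" if "z \<in> K" for z
      using B(1) B(2)[OF that] by (simp add: v_def norm_mult norm_divide field_simps)
    from polynomially_approximable_neumann[OF K f _ this]
    have "(\<lambda>z. (- 1 / v) * (1 / (1 - (1 / v) * z))) \<in> polynomially_approximable K"
      by (intro polynomially_approximable_mult K polynomially_approximable_const) auto
    moreover have "(- 1 / v) * (1 / (1 - (1 / v) * z)) = 1 / (z - v)" if "z \<in> K" for z
    proof -
      have "(- v) * (1 - (1 / v) * z) = z - v" using v0 by (simp add: field_simps)
      then show ?thesis by (metis (no_types, lifting) minus_divide_left minus_divide_right mult_1 times_divide_times_eq)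
    qed
    ultimately have "(\<lambda>z. 1 / (z - v)) \<in> polynomially_approximable K"
      using polynomially_approximable_cong by (metis (no_types, lifting))
    then show ?thesis using vK by (auto simp: P_def)
  qed
  ultimately have "P = - K" using con by (metis connected_clopen)
  then show ?thesis using w by (auto simp: P_def)
qed (simp add: polynomially_approximable_def)

section \<open>Arcs in the complement and continuous extension\<close>

text \<open>A path in the complement leads from \<open>a\<close> to a point outside the disc. It is
  cut where it reaches the bounding circle, so that the far end has distance exactly
  \<open>r\<close>, and an arc is extracted from it.\<close>

lemma arc_in_connected_complement:
  fixes K :: "complex set"
  assumes K: "compact K" and con: "connected (- K)" and a: "a \<notin> K" and r: "r > 0"
  obtains \<gamma> where "arc \<gamma>" "pathstart \<gamma> = a" "path_image \<gamma> \<subseteq> cball a r" "path_image \<gamma> \<subseteq> - K"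
    "r = dist a (pathfinish \<gamma>)"
proof -
  have op: "open (- K)" using K by (simp add: compact_imp_closed open_Compl)
  have "bounded (K \<union> cball a r)" using K by (simp add: compact_imp_bounded)
  then obtain b where b: "b \<notin> K \<union> cball a r"
    using not_bounded_UNIV by (metis UNIV_eq_I)
  have "path_connected (- K)" using op con by (simp add: connected_open_path_connected)
  then obtain g where g: "path g" "path_image g \<subseteq> - K" "pathstart g = a" "pathfinish g = b"
    using a b unfolding path_connected_def by blast
  obtain p where p: "path p" "pathstart p = pathstart g" "path_image p \<subseteq> path_image g \<inter> cball a r"
    "pathfinish p \<in> frontier (cball a r)"
    using exists_path_subpath_to_frontier_closed[of "cball a r" g] g b r by auto
  have fin: "dist a (pathfinish p) = r" using p(4) r by simp
  then have "pathfinish p \<noteq> pathstart p" using p(2) g(3) r by auto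
  then obtain q where q: "arc q" "path_image q \<subseteq> path_image p" "pathstart q = pathstart p" "pathfinish q = pathfinish p"
    using path_contains_arc[OF p(1) refl refl] by metis
  show ?thesis
  proof (rule that[OF q(1)])
    show "pathstart q = a" using q(3) p(2) g(3) by simp
    show "path_image q \<subseteq> cball a r" "path_image q \<subseteq> - K" using q(2) p(3) g(2) by blast+
    show "r = dist a (pathfinish q)" using q(4) fin by simp
  qed
qed

lemma compactly_supported_extension:
  fixes g :: "complex \<Rightarrow> complex"
  assumes S: "compact S" and g: "continuous_on S g"
  obtains f R M where "continuous_on UNIV f" "uniformly_continuous_on UNIV f" "\<And>z. z \<in> S \<Longrightarrow> f z = g z"
    "\<And>z. norm z > R \<Longrightarrow> f z = 0" "\<And>z. norm (f z) \<le> M"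
proof -
  obtain k where k: "continuous_on UNIV k" "\<And>z. z \<in> S \<Longrightarrow> k z = g z"
    using Tietze_unbounded[OF g, of UNIV] S by (auto simp: compact_imp_closed)
  obtain r where r: "r > 0" "\<And>z. z \<in> S \<Longrightarrow> norm z \<le> r"
    using S by (metis compact_imp_bounded bounded_pos)
  \<comment> \<open>The Tietze extension times a cutoff that is 1 up to norm r and 0 from norm r + 1
    on.\<close>
  define f where "f = (\<lambda>z. complex_of_real (max 0 (1 - max 0 (norm z - r))) * k z)"
  have f: "continuous_on UNIV f" unfolding f_def using k(1) by (intro continuous_intros)
  have fS: "f z = g z" if "z \<in> S" for z using k(2)[OF that] r(2)[OF that] by (simp add: f_def)
  have supp: "f z = 0" if "norm z > r + 1" for z using that by (simp add: f_def)
  have "bounded (f ` cball 0 (r + 1))"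
    by (intro compact_imp_bounded compact_continuous_image continuous_on_subset[OF f]) auto
  then obtain M where M: "M > 0" "\<And>z. norm z \<le> r + 1 \<Longrightarrow> norm (f z) \<le> M" by (auto simp: bounded_pos)
  have "norm (f z) \<le> M" for z using M supp[of z] by (cases "norm z \<le> r + 1") auto
  moreover have "uniformly_continuous_on UNIV f"
    unfolding uniformly_continuous_on_def
  proof (intro allI impI)
    fix e :: real assume e: "e > 0"
    have "uniformly_continuous_on (cball 0 (r + 2)) f"
      by (intro compact_uniformly_continuous continuous_on_subset[OF f]) auto
    then obtain d where d: "d > 0" "\<And>x y. norm x \<le> r + 2 \<Longrightarrow> norm y \<le> r + 2 \<Longrightarrow> dist y x < d \<Longrightarrow> dist (f y) (f x) < e"
      using e unfolding uniformly_continuous_on_def by (metis mem_cball_0)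
    \<comment> \<open>At distance below 1, if one point has norm above r + 2, both have norm above r
      + 1, where \<open>f\<close> vanishes.\<close>
    have "dist (f y) (f x) < e" if "dist y x < min d 1" for x y
    proof (cases "norm x \<le> r + 2 \<and> norm y \<le> r + 2")
      case False
      then have "norm x > r + 1 \<and> norm y > r + 1"
        using that norm_triangle_ineq2[of x y] norm_triangle_ineq2[of y x] by (auto simp: dist_norm norm_minus_commute)
      then show ?thesis using supp e by simp
    qed (use that d in auto)
    then show "\<exists>d>0. \<forall>x\<in>UNIV. \<forall>y\<in>UNIV. dist y x < d \<longrightarrow> dist (f y) (f x) < e"
      using d(1) by (intro exI[of _ "min d 1"]) auto
  qed
  ultimately show ?thesis using that[OF f _ fS supp] by blast
qed

subsection \<open>Discretised Cauchy transforms\<close>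

lemma integrable_bounded_support:
  fixes v :: "complex \<Rightarrow> complex"
  assumes v [measurable]: "v \<in> borel_measurable borel" and M: "\<And>\<zeta>. norm (v \<zeta>) \<le> M"
    and supp: "\<And>\<zeta>. norm \<zeta> > R \<Longrightarrow> v \<zeta> = 0"
  shows "integrable lborel v"
proof (rule Bochner_Integration.integrable_bound)
  show "integrable lborel (\<lambda>\<zeta>. indicator (cball (0::complex) R) \<zeta> * M)"
    by (intro integrable_mult_left integrable_real_indicator) (use emeasure_bounded_finite[of "cball (0::complex) R"] in auto)
  have "M \<ge> 0" using M[of 0] norm_ge_zero order_trans by blast
  then show "AE \<zeta> in lborel. norm (v \<zeta>) \<le> norm (indicator (cball (0::complex) R) \<zeta> * M)"
    using M supp by (intro AE_I2) (auto simp: indicator_def not_le)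
qed measurable

definition grid_cell :: "real \<Rightarrow> complex \<Rightarrow> int \<times> int" where
  "grid_cell s \<zeta> = (\<lfloor>Re \<zeta> / s\<rfloor>, \<lfloor>Im \<zeta> / s\<rfloor>)"

lemma grid_cell_dist:
  assumes s: "s > 0" and eq: "grid_cell s \<zeta> = grid_cell s \<zeta>'"
  shows "norm (\<zeta> - \<zeta>') \<le> 2 * s"
proof -
  have *: "\<bar>x - y\<bar> \<le> s" if "\<lfloor>x / s\<rfloor> = \<lfloor>y / s\<rfloor>" for x y :: real
  proof -
    have "\<bar>x / s - y / s\<bar> \<le> 1" using that floor_correct[of "x / s"] floor_correct[of "y / s"] by linarith
    then have "\<bar>(x - y) / s\<bar> \<le> 1" by (simp add: diff_divide_distrib)
    then show ?thesis using s by (simp add: abs_divide)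
  qed
  have "\<bar>Re (\<zeta> - \<zeta>')\<bar> \<le> s" "\<bar>Im (\<zeta> - \<zeta>')\<bar> \<le> s"
    using eq * by (auto simp: grid_cell_def)
  then show ?thesis using cmod_le[of "\<zeta> - \<zeta>'"] by linarith
qed

lemma grid_cell_measurable [measurable]: "Measurable.pred borel (\<lambda>\<zeta>. grid_cell s \<zeta> = j)"
  unfolding grid_cell_def by (cases j) (simp, measurable)

lemma finite_grid_cells:
  assumes s: "s > 0" shows "finite (grid_cell s ` cball 0 R)"
proof (rule finite_subset)
  define N where "N = \<lceil>R / s\<rceil> + 1"
  show "grid_cell s ` cball 0 R \<subseteq> {-N..N} \<times> {-N..N}"
  proof
    fix j assume "j \<in> grid_cell s ` cball 0 R"
    then obtain \<zeta> where \<zeta>: "norm \<zeta> \<le> R" "j = grid_cell s \<zeta>" by auto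
    have *: "\<lfloor>x / s\<rfloor> \<in> {-N..N}" if "\<bar>x\<bar> \<le> R" for x
    proof -
      have "x / s \<le> R / s" "(- x) / s \<le> R / s"
        using that s by (intro divide_right_mono; simp)+
      then have "x / s \<le> R / s" "- (x / s) \<le> R / s" by simp_all
      then show ?thesis unfolding N_def atLeastAtMost_iff by linarith
    qed
    show "j \<in> {-N..N} \<times> {-N..N}"
      using \<zeta> abs_Re_le_cmod[of \<zeta>] abs_Im_le_cmod[of \<zeta>] *[of "Re \<zeta>"] *[of "Im \<zeta>"] by (auto simp: grid_cell_def)
  qed
qed auto

text \<open>On each cell the substitute kernel is affine in \<zeta> with coefficients depending on
  \<open>z\<close>. Integrating it against \<open>u\<close> gives a finite combination of the
  functions \<open>A j\<close> and \<open>B j\<close>, whose weights are the moments of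
  \<open>u\<close> of order 0 and 1 over the cell. The error is at most \<open>U\<close> times the
  integral of \<kappa>.\<close>

lemma cauchy_transform_grid_approx:
  fixes u :: "complex \<Rightarrow> complex"
  assumes K: "compact K" and s: "s > 0"
    and u [measurable]: "u \<in> borel_measurable borel" and U: "\<And>\<zeta>. norm (u \<zeta>) \<le> U"
    and supp: "\<And>\<zeta>. norm \<zeta> > R \<Longrightarrow> u \<zeta> = 0"
    and A: "\<And>j. A j \<in> polynomially_approximable K" and B: "\<And>j. B j \<in> polynomially_approximable K"
    and \<kappa>: "\<And>z \<zeta>. \<lbrakk>z \<in> K; u \<zeta> \<noteq> 0; z \<noteq> \<zeta>\<rbrakk> \<Longrightarrow>
        norm (1 / (z - \<zeta>) - (A (grid_cell s \<zeta>) z + \<zeta> * B (grid_cell s \<zeta>) z)) \<le> \<kappa> z \<zeta>"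
    and \<kappa>_int: "\<And>z. z \<in> K \<Longrightarrow> integrable lborel (\<kappa> z)" "\<And>z. z \<in> K \<Longrightarrow> (\<integral>\<zeta>. \<kappa> z \<zeta> \<partial>lborel) \<le> I"
    and \<kappa>_nonneg: "\<And>z \<zeta>. 0 \<le> \<kappa> z \<zeta>"
  obtains g where "g \<in> polynomially_approximable K"
    "\<And>z. z \<in> K \<Longrightarrow> norm ((\<integral>\<zeta>. u \<zeta> / (z - \<zeta>) \<partial>lborel) - g z) \<le> U * I"
proof -
  define J where "J = grid_cell s ` cball 0 R"
  have finJ: "finite J" unfolding J_def by (rule finite_grid_cells[OF s])
  \<comment> \<open>The integrals of \<open>u0 j\<close> and \<open>u1 j\<close> are the two moments
    over cell j.\<close>
  define u0 where "u0 = (\<lambda>j \<zeta>. if grid_cell s \<zeta> = j then u \<zeta> else 0)"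
  define u1 where "u1 = (\<lambda>j \<zeta>. \<zeta> * u0 j \<zeta>)"
  have U0: "U \<ge> 0" using U[of 0] norm_ge_zero order_trans by blast
  have [measurable]: "u0 j \<in> borel_measurable borel" for j unfolding u0_def by measurable
  have [measurable]: "u1 j \<in> borel_measurable borel" for j unfolding u1_def by measurable
  have i0: "integrable lborel (u0 j)" for j
    by (rule integrable_bounded_support[where M = U and R = R]) (auto simp: u0_def U U0 supp)
  have i1: "integrable lborel (u1 j)" for j
  proof (rule integrable_bounded_support[where M = "\<bar>R\<bar> * U" and R = R])
    fix \<zeta>
    show "norm (u1 j \<zeta>) \<le> \<bar>R\<bar> * U"
    proof (cases "norm \<zeta> > R")
      case False
      then have "norm \<zeta> * norm (u \<zeta>) \<le> \<bar>R\<bar> * U" using U by (intro mult_mono) auto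
      then show ?thesis using U0 by (simp add: u1_def u0_def norm_mult)
    qed (use U0 in \<open>simp add: u1_def u0_def supp\<close>)
  qed (auto simp: u1_def u0_def supp)
  define g where "g = (\<lambda>z. \<Sum>j\<in>J. A j z * (\<integral>\<zeta>. u0 j \<zeta> \<partial>lborel) + B j z * (\<integral>\<zeta>. u1 j \<zeta> \<partial>lborel))"
  have "g \<in> polynomially_approximable K"
    unfolding g_def
    by (intro polynomially_approximable_sum polynomially_approximable_add polynomially_approximable_mult
        polynomially_approximable_const A B K finJ)
  moreover have "norm ((\<integral>\<zeta>. u \<zeta> / (z - \<zeta>) \<partial>lborel) - g z) \<le> U * I" if z: "z \<in> K" for z
  proof -
    have point: "(\<Sum>j\<in>J. A j z * u0 j \<zeta> + B j z * u1 j \<zeta>) = u \<zeta> * (A (grid_cell s \<zeta>) z + \<zeta> * B (grid_cell s \<zeta>) z)" for \<zeta>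
    proof (cases "norm \<zeta> > R")
      case False
      then have "grid_cell s \<zeta> \<in> J" by (auto simp: J_def)
      have "(\<Sum>j\<in>J. A j z * u0 j \<zeta> + B j z * u1 j \<zeta>)
          = (\<Sum>j\<in>J. if grid_cell s \<zeta> = j then u \<zeta> * (A j z + \<zeta> * B j z) else 0)"
        by (intro sum.cong) (auto simp: u0_def u1_def algebra_simps)
      also have "\<dots> = u \<zeta> * (A (grid_cell s \<zeta>) z + \<zeta> * B (grid_cell s \<zeta>) z)"
        using finJ \<open>grid_cell s \<zeta> \<in> J\<close> by simp
      finally show ?thesis .
    qed (auto simp: u0_def u1_def supp intro!: sum.neutral)
    have ig: "integrable lborel (\<lambda>\<zeta>. \<Sum>j\<in>J. A j z * u0 j \<zeta> + B j z * u1 j \<zeta>)"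
      by (intro Bochner_Integration.integrable_sum Bochner_Integration.integrable_add integrable_mult_right i0 i1)
    have ic: "integrable lborel (\<lambda>\<zeta>. u \<zeta> / (z - \<zeta>))"
      by (rule cauchy_transform_integrable[OF u U supp])
    have "g z = (\<integral>\<zeta>. (\<Sum>j\<in>J. A j z * u0 j \<zeta> + B j z * u1 j \<zeta>) \<partial>lborel)"
      unfolding g_def
      by (subst Bochner_Integration.integral_sum)
         (auto intro!: sum.cong Bochner_Integration.integrable_add integrable_mult_right i0 i1
            simp: Bochner_Integration.integral_add i0 i1)
    then have "(\<integral>\<zeta>. u \<zeta> / (z - \<zeta>) \<partial>lborel) - g z
        = (\<integral>\<zeta>. u \<zeta> / (z - \<zeta>) - (\<Sum>j\<in>J. A j z * u0 j \<zeta> + B j z * u1 j \<zeta>) \<partial>lborel)"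
      using ig ic by simp
    also have "norm \<dots> \<le> (\<integral>\<zeta>. norm (u \<zeta> / (z - \<zeta>) - (\<Sum>j\<in>J. A j z * u0 j \<zeta> + B j z * u1 j \<zeta>)) \<partial>lborel)"
      by (rule integral_norm_bound)
    also have "\<dots> \<le> (\<integral>\<zeta>. U * \<kappa> z \<zeta> \<partial>lborel)"
    proof (rule integral_mono_AE)
      show "integrable lborel (\<lambda>\<zeta>. norm (u \<zeta> / (z - \<zeta>) - (\<Sum>j\<in>J. A j z * u0 j \<zeta> + B j z * u1 j \<zeta>)))"
        by (intro integrable_norm Bochner_Integration.integrable_diff ig ic)
      show "integrable lborel (\<lambda>\<zeta>. U * \<kappa> z \<zeta>)" by (intro integrable_mult_right \<kappa>_int z)
      have "AE \<zeta> in lborel. \<zeta> \<noteq> z" by (rule AE_lborel_singleton)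
      then show "AE \<zeta> in lborel. norm (u \<zeta> / (z - \<zeta>) - (\<Sum>j\<in>J. A j z * u0 j \<zeta> + B j z * u1 j \<zeta>)) \<le> U * \<kappa> z \<zeta>"
      proof eventually_elim
        case (elim \<zeta>)
        show ?case
        proof (cases "u \<zeta> = 0")
          case False
          have "norm (u \<zeta> / (z - \<zeta>) - u \<zeta> * (A (grid_cell s \<zeta>) z + \<zeta> * B (grid_cell s \<zeta>) z))
              = norm (u \<zeta>) * norm (1 / (z - \<zeta>) - (A (grid_cell s \<zeta>) z + \<zeta> * B (grid_cell s \<zeta>) z))"
            by (simp add: algebra_simps flip: norm_mult)
          also have "\<dots> \<le> U * \<kappa> z \<zeta>"
            using \<kappa>[OF z False] elim U0 by (intro mult_mono U) auto
          finally show ?thesis unfolding point .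
        qed (use U0 \<kappa>_nonneg in \<open>simp add: point\<close>)
      qed
    qed
    also have "\<dots> = U * (\<integral>\<zeta>. \<kappa> z \<zeta> \<partial>lborel)" by (rule integral_mult_right_zero)
    also have "\<dots> \<le> U * I" using \<kappa>_int(2)[OF z] U0 by (rule mult_left_mono)
    finally show ?thesis .
  qed
  ultimately show ?thesis by (rule that)
qed

text \<open>The error is measured in units of h^2 because the normalisation divides by 8 pi i h^2;
  the remaining factor 1 / (8 pi) is at most 1.\<close>

lemma approximation_from_cauchy_transform:
  assumes h: "h > 0" and f: "continuous_on UNIV f" and supp: "\<And>\<zeta>. norm \<zeta> > R \<Longrightarrow> f \<zeta> = 0"
    and M: "\<And>\<zeta>. norm (f \<zeta>) \<le> M" and \<omega>: "\<And>z w. w \<in> cball z (2 * h) \<Longrightarrow> norm (f w - f z) \<le> \<omega>"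
    and g: "g \<in> polynomially_approximable K" and K: "compact K"
    and le: "\<And>z. z \<in> K \<Longrightarrow> norm ((\<integral>\<zeta>. square_contour_integral h f \<zeta> / (z - \<zeta>) \<partial>lborel) - g z) \<le> h\<^sup>2 * C"
  shows "\<exists>g\<in>polynomially_approximable K. \<forall>z\<in>K. norm (f z - g z) \<le> \<omega> + C"
proof (rule bexI)
  let ?c = "8 * pi * \<i> * h\<^sup>2"
  show "(\<lambda>z. 1 / ?c * g z) \<in> polynomially_approximable K"
    by (intro polynomially_approximable_mult polynomially_approximable_const K g)
  show "\<forall>z\<in>K. norm (f z - 1 / ?c * g z) \<le> \<omega> + C"
  proof
    fix z assume z: "z \<in> K"
    let ?I = "\<integral>\<zeta>. square_contour_integral h f \<zeta> / (z - \<zeta>) \<partial>lborel"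
    have 1: "norm (?I / ?c - f z) \<le> \<omega>"
      using cauchy_transform_square_contour_integral_approx[OF h f supp M \<omega>] by simp
    have C0: "C \<ge> 0" using order_trans[OF norm_ge_zero le[OF z]] h by (simp add: zero_le_mult_iff)
    have nc: "norm ?c = 8 * pi * h\<^sup>2" using h by (simp add: norm_mult norm_power)
    have "norm ((?I - g z) / ?c) \<le> (h\<^sup>2 * C) / (8 * pi * h\<^sup>2)"
      unfolding norm_divide nc using le[OF z] h by (intro divide_right_mono) auto
    also have "\<dots> = C / (8 * pi)" using h by (simp add: field_simps)
    also have "\<dots> \<le> C / 1" using C0 pi_ge_two by (intro divide_left_mono) auto
    finally have 2: "norm ((?I - g z) / ?c) \<le> C" by simp
    have "f z - 1 / ?c * g z = (?I - g z) / ?c - (?I / ?c - f z)"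
      by (simp add: diff_divide_distrib)
    then show "norm (f z - 1 / ?c * g z) \<le> \<omega> + C"
      using 1 2 norm_triangle_ineq4[of "(?I - g z) / ?c" "?I / ?c - f z"] by (simp only:)
  qed
qed

subsection \<open>The theorems of Runge and Mergelyan\<close>

text \<open>The scheme of Mergelyan's theorem in an easy case: \<open>f\<close> is holomorphic near
  \<open>K\<close>, so the density vanishes near \<open>K\<close>. On a fine grid the Cauchy kernel
  may then be replaced by 1 / (z - P) with one point P per cell, and such functions are approximable
  by the moving of poles.\<close>

theorem Runge_polynomial:
  assumes K: "compact K" and con: "connected (- K)" and U: "open U" "K \<subseteq> U" and g: "g holomorphic_on U"
  shows "g \<in> polynomially_approximable K"
proof (cases "K = {}")
  case True
  then show ?thesis by (simp add: polynomially_approximable_def)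
next
  case ne: False
  show ?thesis
  proof (rule polynomially_approximable_closed)
    fix \<epsilon> :: real assume \<epsilon>: "\<epsilon> > 0"
    obtain d where d: "d > 0" "(\<Union>x\<in>K. cball x d) \<subseteq> U"
      using compact_subset_open_imp_cball_epsilon_subset[OF K U] by blast
    define S where "S = {z. infdist z K \<le> d}"
    have SU: "S \<subseteq> U"
    proof
      fix z assume "z \<in> S"
      obtain x where "x \<in> K" "infdist z K = dist z x"
        using infdist_attains_inf[of K z] K ne compact_imp_closed by blast
      then have "z \<in> cball x d" using \<open>z \<in> S\<close> by (simp add: S_def dist_commute)
      then show "z \<in> U" using d(2) \<open>x \<in> K\<close> by blast
    qed
    have KS: "K \<subseteq> S" using d by (auto simp: S_def)
    have "closed S" unfolding S_def by (intro closed_Collect_le continuous_intros)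
    moreover have "bounded S"
    proof -
      obtain B where B: "\<And>x. x \<in> K \<Longrightarrow> norm x \<le> B" using K by (meson compact_imp_bounded bounded_iff)
      have "norm z \<le> B + d" if "z \<in> S" for z
      proof -
        obtain x where x: "x \<in> K" "infdist z K = dist z x"
          using infdist_attains_inf[of K z] K ne compact_imp_closed by blast
        then have "norm (z - x) \<le> d" using that by (simp add: S_def dist_norm)
        then show ?thesis using B[OF x(1)] norm_triangle_sub[of z x] by linarith
      qed
      then show ?thesis unfolding bounded_iff by blast
    qed
    ultimately have S: "compact S" by (simp add: compact_eq_bounded_closed)
    obtain f R M where f: "continuous_on UNIV f" "uniformly_continuous_on UNIV f" "\<And>z. z \<in> S \<Longrightarrow> f z = g z"
      "\<And>z. norm z > R \<Longrightarrow> f z = 0" "\<And>z. norm (f z) \<le> M"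
      by (rule compactly_supported_extension[OF S holomorphic_on_imp_continuous_on[OF holomorphic_on_subset[OF g SU]]], rule that)
    obtain \<delta> where \<delta>: "\<delta> > 0" "\<And>x y. dist y x < \<delta> \<Longrightarrow> dist (f y) (f x) < \<epsilon> / 3"
      using f(2) \<epsilon> unfolding uniformly_continuous_on_def by (metis UNIV_I divide_pos_pos zero_less_numeral)
    \<comment> \<open>The bound d / 8 ensures that discs of radius 2 h about points closer than d /
      2 to \<open>K\<close> stay within distance d, where \<open>f\<close> is holomorphic.\<close>
    define h where "h = min (\<delta> / 4) (d / 8)"
    have h: "h > 0" "2 * h < \<delta>" "4 * h \<le> d" using \<delta> d by (auto simp: h_def)
    have \<omega>: "norm (f w - f z) \<le> \<epsilon> / 3" if "w \<in> cball z (2 * h)" for w z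
      using \<delta>(2)[of w z] h that by (auto simp: dist_norm norm_minus_commute)
    define u where "u = square_contour_integral h f"
    have bu: "norm (u \<zeta>) \<le> 8 * h * (\<epsilon> / 3)" for \<zeta>
      unfolding u_def using \<epsilon> by (intro square_contour_integral_bound h f \<omega>) auto
    have su: "u \<zeta> = 0" if "norm \<zeta> > R + 2 * h" for \<zeta>
      unfolding u_def by (rule square_contour_integral_support[OF h(1) f(4) that])
    have mu: "u \<in> borel_measurable borel"
      unfolding u_def by (rule cauchy_transform_square_contour_integral(2)[OF h(1) f(1,4,5)])
    have holf: "f holomorphic_on {z. infdist z K < d}"
      by (rule holomorphic_transform[OF holomorphic_on_subset[OF g]]) (use SU f(3) in \<open>force simp: S_def\<close>)+
    have far: "d / 2 \<le> infdist \<zeta> K" if "u \<zeta> \<noteq> 0" for \<zeta>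
    proof (rule ccontr)
      assume "\<not> d / 2 \<le> infdist \<zeta> K"
      have "cball \<zeta> (2 * h) \<subseteq> {z. infdist z K < d}"
      proof
        fix w assume "w \<in> cball \<zeta> (2 * h)"
        then show "w \<in> {z. infdist z K < d}"
          using infdist_triangle[of w K \<zeta>] \<open>\<not> d / 2 \<le> infdist \<zeta> K\<close> h(3) by (simp add: dist_commute)
      qed
      then have "cbox (\<zeta> - Complex h h) (\<zeta> + Complex h h) \<subseteq> {z. infdist z K < d}"
        using square_subset_cball[OF h(1)] by blast
      then show False using square_contour_integral_eq_0[OF h(1) holf] that by (simp add: u_def)
    qed
    define V where "V = measure lborel (cball (0::complex) (R + 2 * h))"
    \<comment> \<open>Replacing a pole inside a cell costs at most 2 s / (d / 2)^2 = 8 s / d^2;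
      integrated over the support, of area at most \<open>V\<close>, this must not exceed h / 8. The
      summand 1 avoids division by zero.\<close>
    define s where "s = h * d\<^sup>2 / (64 * (V + 1))"
    have V0: "V \<ge> 0" by (simp add: V_def)
    have s: "s > 0" using h d V0 by (simp add: s_def)
    \<comment> \<open>The representative is taken where \<open>u\<close> does not vanish, which
      keeps it at distance at least d / 2 from \<open>K\<close>; cells without such a point get the
      function 0.\<close>
    define P where "P = (\<lambda>j. SOME \<zeta>. grid_cell s \<zeta> = j \<and> u \<zeta> \<noteq> 0)"
    define A where "A = (\<lambda>j z. if \<exists>\<zeta>. grid_cell s \<zeta> = j \<and> u \<zeta> \<noteq> 0 then 1 / (z - P j) else 0)"
    have P: "grid_cell s (P (grid_cell s \<zeta>)) = grid_cell s \<zeta>" "u (P (grid_cell s \<zeta>)) \<noteq> 0" if "u \<zeta> \<noteq> 0" for \<zeta>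
      using someI_ex[of "\<lambda>\<xi>. grid_cell s \<xi> = grid_cell s \<zeta> \<and> u \<xi> \<noteq> 0"] that by (auto simp: P_def)
    have A: "A j \<in> polynomially_approximable K" for j
    proof (cases "\<exists>\<zeta>. grid_cell s \<zeta> = j \<and> u \<zeta> \<noteq> 0")
      case True
      then have "u (P j) \<noteq> 0" using P(2) by blast
      then have "P j \<notin> K" using far[of "P j"] d(1) by auto
      then show ?thesis using True polynomially_approximable_pole[OF K con] by (simp add: A_def)
    next
      case False
      show ?thesis unfolding A_def if_not_P[OF False] by (rule polynomially_approximable_const)
    qed
    define \<kappa> where "\<kappa> = (\<lambda>(z::complex) \<zeta>. (8 * s / d\<^sup>2) * indicator (cball (0::complex) (R + 2 * h)) \<zeta>)"
    have ind: "integrable lborel (indicator (cball (0::complex) (R + 2 * h)) :: complex \<Rightarrow> real)"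
      using emeasure_bounded_finite[of "cball (0::complex) (R + 2 * h)"] by (intro integrable_real_indicator) auto
    obtain G where G: "G \<in> polynomially_approximable K"
      "\<And>z. z \<in> K \<Longrightarrow> norm ((\<integral>\<zeta>. u \<zeta> / (z - \<zeta>) \<partial>lborel) - G z) \<le> (8 * h * (\<epsilon> / 3)) * (h / 8)"
    proof (rule cauchy_transform_grid_approx[OF K s mu bu su A polynomially_approximable_const[of 0], where \<kappa> = \<kappa> and I = "h / 8"])
      show "integrable lborel (\<kappa> z)" for z unfolding \<kappa>_def by (intro integrable_mult_right ind)
      show "0 \<le> \<kappa> z \<zeta>" for z \<zeta> using s by (simp add: \<kappa>_def)
      have "(\<integral>\<zeta>. \<kappa> z \<zeta> \<partial>lborel) = (8 * s / d\<^sup>2) * V" for z by (simp add: \<kappa>_def V_def)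
      moreover have "(8 * s / d\<^sup>2) * V = h / 8 * (V / (V + 1))"
      proof -
        have "8 * (h * d\<^sup>2 / (64 * w)) / d\<^sup>2 = h / (8 * w)" if "w > 0" for w
          using that d(1) by (simp add: field_simps)
        from this[of "V + 1"] have "8 * s / d\<^sup>2 = h / (8 * (V + 1))" using V0 by (simp add: s_def)
        then show ?thesis by simp
      qed
      moreover have "h / 8 * (V / (V + 1)) \<le> h / 8 * 1" using h V0 by (intro mult_left_mono) auto
      ultimately show "(\<integral>\<zeta>. \<kappa> z \<zeta> \<partial>lborel) \<le> h / 8" for z by simp
      fix z \<zeta> assume z: "z \<in> K" and \<zeta>: "u \<zeta> \<noteq> 0"
      let ?p = "P (grid_cell s \<zeta>)"
      have dz: "d / 2 \<le> norm (z - \<xi>)" if "u \<xi> \<noteq> 0" for \<xi>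
        using far[OF that] infdist_le[OF z, of \<xi>] by (simp add: dist_norm norm_minus_commute)
      have n: "d / 2 \<le> norm (z - \<zeta>)" "d / 2 \<le> norm (z - ?p)" using dz \<zeta> P(2)[OF \<zeta>] by auto
      then have ne: "z \<noteq> \<zeta>" "z \<noteq> ?p" using d(1) by auto
      have "norm (\<zeta> - ?p) \<le> 2 * s" using grid_cell_dist[OF s P(1)[OF \<zeta>, symmetric]] .
      have "1 / (z - \<zeta>) - 1 / (z - ?p) = (\<zeta> - ?p) / ((z - \<zeta>) * (z - ?p))"
        using ne by (simp add: field_simps)
      also have "norm \<dots> \<le> (2 * s) / (d / 2 * (d / 2))"
        unfolding norm_divide norm_mult using n d(1) s \<open>norm (\<zeta> - ?p) \<le> 2 * s\<close> by (intro frac_le mult_mono) auto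
      also have "\<dots> = 8 * s / d\<^sup>2" by (simp add: power2_eq_square)
      finally have "norm (1 / (z - \<zeta>) - 1 / (z - ?p)) \<le> 8 * s / d\<^sup>2" .
      moreover have "norm \<zeta> \<le> R + 2 * h" using su[of \<zeta>] \<zeta> by (meson not_le)
      moreover have "A (grid_cell s \<zeta>) z = 1 / (z - ?p)" using \<zeta> by (auto simp: A_def)
      ultimately show "norm (1 / (z - \<zeta>) - (A (grid_cell s \<zeta>) z + \<zeta> * 0)) \<le> \<kappa> z \<zeta>"
        by (simp add: \<kappa>_def)
    qed (assumption, rule that)
    have "\<exists>k\<in>polynomially_approximable K. \<forall>z\<in>K. norm (f z - k z) \<le> \<epsilon> / 3 + \<epsilon> / 3"
    proof (rule approximation_from_cauchy_transform[OF h(1) f(1,4,5) \<omega> G(1) K])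
      fix z assume "z \<in> K"
      have eq: "8 * h * (\<epsilon> / 3) * (h / 8) = h\<^sup>2 * (\<epsilon> / 3)" by (simp add: power2_eq_square)
      show "norm ((\<integral>\<zeta>. square_contour_integral h f \<zeta> / (z - \<zeta>) \<partial>lborel) - G z) \<le> h\<^sup>2 * (\<epsilon> / 3)"
        using G(2)[OF \<open>z \<in> K\<close>] unfolding eq u_def .
    qed
    then obtain k where k: "k \<in> polynomially_approximable K" "\<forall>z\<in>K. norm (f z - k z) \<le> \<epsilon> / 3 + \<epsilon> / 3" by blast
    have "norm (g z - k z) < \<epsilon>" if "z \<in> K" for z
    proof -
      have "norm (f z - k z) \<le> \<epsilon> / 3 + \<epsilon> / 3" using k(2) that by blast
      then show ?thesis using f(3)[of z] KS that \<epsilon> by auto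
    qed
    then show "\<exists>k\<in>polynomially_approximable K. \<forall>z\<in>K. norm (g z - k z) < \<epsilon>" using k(1) by blast
  qed
qed

text \<open>The scales are tied together: grid side h, arcs of radius 5 h, density at most 8 h
  \<omega>, kernel integral O(h). The error before normalisation is therefore a constant times h^2
  \<omega>, however small h is.\<close>

theorem Mergelyan:
  assumes K: "compact K" and con: "connected (- K)" and g: "g \<in> A_algebra K"
  shows "g \<in> polynomially_approximable K"
proof (rule polynomially_approximable_closed)
  fix \<epsilon> :: real assume \<epsilon>: "\<epsilon> > 0"
  \<comment> \<open>The final error is \<omega> + 10^11 \<omega>, which is below \<epsilon> for this
    choice.\<close>
  define \<omega> where "\<omega> = \<epsilon> / 10 ^ 12"
  have \<omega>0: "\<omega> > 0" using \<epsilon> by (simp add: \<omega>_def)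
  have cg: "continuous_on K g" and hg: "g holomorphic_on interior K" using g by (auto simp: A_algebra_def)
  obtain f R M where f: "continuous_on UNIV f" "uniformly_continuous_on UNIV f" "\<And>z. z \<in> K \<Longrightarrow> f z = g z"
    "\<And>z. norm z > R \<Longrightarrow> f z = 0" "\<And>z. norm (f z) \<le> M"
    by (rule compactly_supported_extension[OF K cg], rule that)
  obtain \<delta> where \<delta>: "\<delta> > 0" "\<And>x y. dist y x < \<delta> \<Longrightarrow> dist (f y) (f x) < \<omega>"
    using f(2) \<omega>0 unfolding uniformly_continuous_on_def by (metis UNIV_I)
  define h where "h = \<delta> / 4"
  have h: "h > 0" "2 * h < \<delta>" using \<delta> by (auto simp: h_def)
  have \<omega>: "norm (f w - f z) \<le> \<omega>" if "w \<in> cball z (2 * h)" for w z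
    using \<delta>(2)[of w z] h that by (auto simp: dist_norm norm_minus_commute)
  define u where "u = square_contour_integral h f"
  have bu: "norm (u \<zeta>) \<le> 8 * h * \<omega>" for \<zeta>
    unfolding u_def using \<omega>0 by (intro square_contour_integral_bound h f \<omega>) auto
  have su: "u \<zeta> = 0" if "norm \<zeta> > R + 2 * h" for \<zeta>
    unfolding u_def by (rule square_contour_integral_support[OF h(1) f(4) that])
  have mu: "u \<in> borel_measurable borel"
    unfolding u_def by (rule cauchy_transform_square_contour_integral(2)[OF h(1) f(1,4,5)])
  have holf: "f holomorphic_on interior K"
    by (rule holomorphic_transform[OF hg]) (use f(3) interior_subset in force)
  \<comment> \<open>5 h = 3 h + 2 h: the arc starts within 3 h of a point \<xi> of the cell, and
    every point of the cell is within 2 h of \<xi>.\<close>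
  define r where "r = 5 * h"
  have r: "r > 0" using h by (simp add: r_def)
  define good where "good = (\<lambda>a b \<zeta>. \<forall>z\<in>K. z \<noteq> \<zeta> \<longrightarrow> norm (1 / (z - \<zeta>) - (a z + \<zeta> * b z)) \<le> 3000000 * decay_kernel r (z - \<zeta>))"
  have "\<exists>a b. a \<in> polynomially_approximable K \<and> b \<in> polynomially_approximable K \<and>
      (\<forall>\<zeta>. grid_cell h \<zeta> = j \<and> u \<zeta> \<noteq> 0 \<longrightarrow> good a b \<zeta>)" for j
  proof (cases "\<exists>\<zeta>. grid_cell h \<zeta> = j \<and> u \<zeta> \<noteq> 0")
    case False
    then show ?thesis using polynomially_approximable_const by blast
  next
    case True
    then obtain \<xi> where \<xi>: "grid_cell h \<xi> = j" "u \<xi> \<noteq> 0" by blast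
    \<comment> \<open>A nonzero density at \<xi> forces the disc out of the interior of
      \<open>K\<close>, hence complement points lie within 2 h + h of \<xi>.\<close>
    have "\<not> cball \<xi> (2 * h) \<subseteq> interior K"
    proof
      assume "cball \<xi> (2 * h) \<subseteq> interior K"
      then have "cbox (\<xi> - Complex h h) (\<xi> + Complex h h) \<subseteq> interior K"
        using square_subset_cball[OF h(1)] by blast
      then show False using square_contour_integral_eq_0[OF h(1) holf] \<xi>(2) by (simp add: u_def)
    qed
    then obtain v where v: "v \<in> cball \<xi> (2 * h)" "v \<in> closure (- K)"
      unfolding closure_complement by blast
    then obtain a where a: "a \<notin> K" "dist a v < h"
      using h(1) unfolding closure_approachable by blast
    have a\<xi>: "dist a \<xi> \<le> 3 * h" using v(1) a(2) dist_triangle[of a \<xi> v] by (simp add: dist_commute)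
    obtain \<gamma> where \<gamma>: "arc \<gamma>" "pathstart \<gamma> = a" "path_image \<gamma> \<subseteq> cball a r" "path_image \<gamma> \<subseteq> - K"
      "r = dist a (pathfinish \<gamma>)"
      using arc_in_connected_complement[OF K con a(1) r] by metis
    obtain k b where kb: "k holomorphic_on - path_image \<gamma>"
      "\<And>\<zeta> z. \<lbrakk>\<zeta> \<in> cball a r; z \<notin> path_image \<gamma>; z \<noteq> \<zeta>\<rbrakk> \<Longrightarrow>
       norm (1 / (z - \<zeta>) - (k z + (\<zeta> - b) * (k z)\<^sup>2)) \<le> 3000000 * decay_kernel r (z - \<zeta>)"
      by (rule arc_cauchy_kernel_approx[OF \<gamma>(1,2) refl \<gamma>(3,5)], rule that)
    have "closed (path_image \<gamma>)" using \<gamma>(1) by (simp add: closed_arc_image)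
    then have k: "k \<in> polynomially_approximable K"
      using \<gamma>(4) by (intro Runge_polynomial[OF K con _ _ kb(1)]) (auto simp: open_Compl)
    have k2: "(\<lambda>z. (k z)\<^sup>2) \<in> polynomially_approximable K"
      by (rule polynomially_approximable_power[OF K k])
    \<comment> \<open>Expanding k + (\<zeta> - b) k^2 as (k - b k^2) + \<zeta> k^2 separates \<zeta>
      from \<open>z\<close>.\<close>
    have k1: "(\<lambda>z. k z + (- b) * (k z)\<^sup>2) \<in> polynomially_approximable K"
      by (intro polynomially_approximable_add polynomially_approximable_mult polynomially_approximable_const K k k2)
    have "good (\<lambda>z. k z + (- b) * (k z)\<^sup>2) (\<lambda>z. (k z)\<^sup>2) \<zeta>" if "grid_cell h \<zeta> = j" for \<zeta>
      unfolding good_def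
    proof (intro ballI impI)
      fix z assume z: "z \<in> K" "z \<noteq> \<zeta>"
      have "norm (\<zeta> - \<xi>) \<le> 2 * h" by (rule grid_cell_dist) (use h that \<xi> in auto)
      then have "\<zeta> \<in> cball a r" using a\<xi> dist_triangle[of a \<zeta> \<xi>] by (simp add: r_def dist_norm norm_minus_commute)
      from kb(2)[OF this _ z(2)] z(1) \<gamma>(4)
      show "norm (1 / (z - \<zeta>) - (k z + (- b) * (k z)\<^sup>2 + \<zeta> * (k z)\<^sup>2)) \<le> 3000000 * decay_kernel r (z - \<zeta>)"
        by (auto simp: algebra_simps)
    qed
    then show ?thesis using k1 k2 by blast
  qed
  then obtain A B where AB: "\<And>j. A j \<in> polynomially_approximable K" "\<And>j. B j \<in> polynomially_approximable K"
    "\<And>j \<zeta>. grid_cell h \<zeta> = j \<Longrightarrow> u \<zeta> \<noteq> 0 \<Longrightarrow> good (A j) (B j) \<zeta>"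
    by metis
  define I where "I = 3000000 * (8 * pi\<^sup>2 * r)"
  obtain G where G: "G \<in> polynomially_approximable K"
    "\<And>z. z \<in> K \<Longrightarrow> norm ((\<integral>\<zeta>. u \<zeta> / (z - \<zeta>) \<partial>lborel) - G z) \<le> 8 * h * \<omega> * I"
  proof (rule cauchy_transform_grid_approx[OF K h(1) mu bu su AB(1,2), where \<kappa> = "\<lambda>z \<zeta>. 3000000 * decay_kernel r (z - \<zeta>)" and I = I])
    show "norm (1 / (z - \<zeta>) - (A (grid_cell h \<zeta>) z + \<zeta> * B (grid_cell h \<zeta>) z)) \<le> 3000000 * decay_kernel r (z - \<zeta>)"
      if "z \<in> K" "u \<zeta> \<noteq> 0" "z \<noteq> \<zeta>" for z \<zeta>
      using AB(3)[OF refl that(2)] that unfolding good_def by blast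
    show "integrable lborel (\<lambda>\<zeta>. 3000000 * decay_kernel r (z - \<zeta>))" for z
      by (intro integrable_mult_right decay_kernel_integrable_lborel r)
    show "(\<integral>\<zeta>. 3000000 * decay_kernel r (z - \<zeta>) \<partial>lborel) \<le> I" for z
      unfolding I_def integral_mult_right_zero using decay_kernel_integrable_lborel(2)[OF r, of z] by (rule mult_left_mono) simp
    show "0 \<le> 3000000 * decay_kernel r (z - \<zeta>)" for z \<zeta> by (simp add: decay_kernel_nonneg)
  qed (assumption, rule that)
  have "\<exists>k\<in>polynomially_approximable K. \<forall>z\<in>K. norm (f z - k z) \<le> \<omega> + \<omega> * 10 ^ 11"
  proof (rule approximation_from_cauchy_transform[OF h(1) f(1,4,5) \<omega> G(1) K])
    fix z assume "z \<in> K"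
    have "pi\<^sup>2 \<le> 4\<^sup>2" using pi_less_4 pi_ge_zero by (intro power_mono) auto
    \<comment> \<open>The constant is 8 * 3000000 * 8 * 5, and pi^2 \<le> 16 keeps the product below
      10^11.\<close>
    have "8 * h * \<omega> * I = h\<^sup>2 * (\<omega> * (960000000 * pi\<^sup>2))"
      by (simp add: I_def r_def power2_eq_square)
    also have "\<dots> \<le> h\<^sup>2 * (\<omega> * 10 ^ 11)"
      using \<open>pi\<^sup>2 \<le> 4\<^sup>2\<close> \<omega>0 by (intro mult_left_mono) auto
    finally have "8 * h * \<omega> * I \<le> h\<^sup>2 * (\<omega> * 10 ^ 11)" .
    from order_trans[OF G(2)[OF \<open>z \<in> K\<close>] this]
    show "norm ((\<integral>\<zeta>. square_contour_integral h f \<zeta> / (z - \<zeta>) \<partial>lborel) - G z) \<le> h\<^sup>2 * (\<omega> * 10 ^ 11)"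
      unfolding u_def .
  qed
  then obtain k where k: "k \<in> polynomially_approximable K" "\<forall>z\<in>K. norm (f z - k z) \<le> \<omega> + \<omega> * 10 ^ 11" by blast
  have "norm (g z - k z) < \<epsilon>" if "z \<in> K" for z
  proof -
    have "norm (f z - k z) \<le> \<omega> + \<omega> * 10 ^ 11" using k(2) that by blast
    then show ?thesis using f(3)[OF that] \<epsilon> by (simp add: \<omega>_def)
  qed
  then show "\<exists>k\<in>polynomially_approximable K. \<forall>z\<in>K. norm (g z - k z) < \<epsilon>" using k(1) by blast
qed

subsection \<open>Generators\<close>

text \<open>For compact plane sets, not separating the plane is equivalent to being Borsukian: every
  continuous map into the punctured plane is homotopic to a constant. The latter is a homeomorphism
  invariant.\<close>

lemma connected_complement_homeomorphic:
  fixes K L :: "complex set"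
  assumes "compact K" "compact L" "K homeomorphic L"
  shows "connected (- K) \<longleftrightarrow> connected (- L)"
  using assms homeomorphic_Borsukian_eq by (simp add: Borsukian_separation_compact[symmetric])

lemma generated_closed_subalgebra_subset_A_algebra:
  assumes \<phi>: "\<phi> \<in> A_algebra K"
  shows "generated_closed_subalgebra K \<phi> \<subseteq> A_algebra K"
proof
  fix f assume "f \<in> generated_closed_subalgebra K \<phi>"
  then obtain p where p: "uniform_limit K (\<lambda>n z. poly (p n) (\<phi> z)) f sequentially"
    by (auto simp: generated_closed_subalgebra_def)
  have c: "continuous_on K \<phi>" and h: "\<phi> holomorphic_on interior K" using \<phi> by (auto simp: A_algebra_def)
  have "continuous_on K f"
    by (rule uniform_limit_theorem[OF _ p]) (auto intro!: always_eventually continuous_intros c)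
  moreover have "f holomorphic_on interior K"
  proof (rule holomorphic_uniform_sequence)
    show "(\<lambda>z. poly (p n) (\<phi> z)) holomorphic_on interior K" for n by (intro holomorphic_intros h)
    fix x assume "x \<in> interior K"
    then obtain d where d: "d > 0" "cball x d \<subseteq> interior K" using open_contains_cball[of "interior K"] by auto
    moreover have "uniform_limit (cball x d) (\<lambda>n z. poly (p n) (\<phi> z)) f sequentially"
      using d(2) interior_subset by (intro uniform_limit_on_subset[OF p]) blast
    ultimately show "\<exists>d>0. cball x d \<subseteq> interior K \<and> uniform_limit (cball x d) (\<lambda>n z. poly (p n) (\<phi> z)) f sequentially"
      by blast
  qed simp
  ultimately show "f \<in> A_algebra K" by (simp add: A_algebra_def)
qed

text \<open>The identity belongs to A(K), and limits of polynomials in \<phi> cannot separate points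
  that \<phi> identifies.\<close>

lemma generator_inj_on:
  assumes "is_generator K \<phi>"
  shows "inj_on \<phi> K"
proof (rule inj_onI)
  fix x y assume xy: "x \<in> K" "y \<in> K" "\<phi> x = \<phi> y"
  have "(\<lambda>z. z) \<in> A_algebra K" by (auto simp: A_algebra_def)
  then obtain p where p: "uniform_limit K (\<lambda>n z. poly (p n) (\<phi> z)) (\<lambda>z. z) sequentially"
    using assms by (auto simp: is_generator_def generated_closed_subalgebra_def)
  from tendsto_uniform_limitI[OF p xy(1)] tendsto_uniform_limitI[OF p xy(2)]
  show "x = y" using xy(3) LIMSEQ_unique by metis
qed

text \<open>Let b lie in a bounded component V of the complement of \<phi>(K), and let p approximate
  1 / (w - b) on \<phi>(K). Then q(w) = (w - b) p(w) - 1 is at most 1/2 on the frontier of V, yet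
  q(b) = -1, against the maximum principle.\<close>

lemma generator_connected_complement_image:
  assumes K: "compact K" and \<phi>: "\<phi> \<in> A_algebra K" and gen: "is_generator K \<phi>"
  shows "connected (- \<phi> ` K)"
proof (rule ccontr)
  let ?L = "\<phi> ` K"
  assume disc: "\<not> connected (- ?L)"
  have c: "continuous_on K \<phi>" and h: "\<phi> holomorphic_on interior K" using \<phi> by (auto simp: A_algebra_def)
  have L: "compact ?L" using c K by (rule compact_continuous_image)
  obtain V where V: "V \<in> components (- ?L)" "bounded V"
    using cobounded_has_bounded_component[of "- ?L"] disc L by (auto simp: compact_imp_bounded)
  obtain b where b: "b \<in> V" using in_components_nonempty[OF V(1)] by blast
  have bL: "b \<notin> ?L" using b in_components_subset[OF V(1)] by blast
  then have ne: "\<phi> z - b \<noteq> 0" if "z \<in> K" for z using that by auto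
  have ne': "\<phi> z - b \<noteq> 0" if "z \<in> interior K" for z using ne that interior_subset by blast
  have "(\<lambda>z. 1 / (\<phi> z - b)) \<in> A_algebra K"
    unfolding A_algebra_def using ne ne' by (auto intro!: continuous_intros holomorphic_intros c h)
  then obtain p where p: "uniform_limit K (\<lambda>n z. poly (p n) (\<phi> z)) (\<lambda>z. 1 / (\<phi> z - b)) sequentially"
    using gen by (auto simp: is_generator_def generated_closed_subalgebra_def)
  obtain B where B: "B > 0" "\<And>w. w \<in> ?L \<Longrightarrow> norm w \<le> B" using L by (metis compact_imp_bounded bounded_pos)
  \<comment> \<open>\<open>?C\<close> bounds |w - b| on \<phi>(K), so accuracy 1 / (2 ?C) makes the
    norm of \<open>q\<close> at most 1/2 there.\<close>
  let ?C = "B + norm b"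
  have C: "?C > 0" using B(1) by (simp add: add_pos_nonneg)
  then have "\<forall>\<^sub>F n in sequentially. \<forall>z\<in>K. dist (poly (p n) (\<phi> z)) (1 / (\<phi> z - b)) < 1 / (2 * ?C)"
    by (intro uniform_limitD[OF p]) simp
  then obtain n where n: "\<And>z. z \<in> K \<Longrightarrow> dist (poly (p n) (\<phi> z)) (1 / (\<phi> z - b)) < 1 / (2 * ?C)"
    by (auto simp: eventually_sequentially)
  define q where "q = (\<lambda>w. (w - b) * poly (p n) w - 1)"
  have q: "q holomorphic_on S" for S unfolding q_def by (intro holomorphic_intros)
  have "norm (q b) \<le> 1 / 2"
  proof (rule maximum_modulus_frontier[OF q holomorphic_on_imp_continuous_on[OF q] V(2) _ b])
    fix w assume "w \<in> frontier V"
    then have "w \<in> ?L" using frontier_of_components_closed_complement[OF compact_imp_closed[OF L] V(1)] by blast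
    then obtain z where z: "z \<in> K" "w = \<phi> z" by blast
    have "q w = (w - b) * (poly (p n) w - 1 / (w - b))" using ne[OF z(1)] z(2) by (simp add: q_def algebra_simps)
    moreover have "norm (w - b) \<le> ?C" using B(2)[OF \<open>w \<in> ?L\<close>] norm_triangle_ineq4[of w b] by linarith
    moreover have "norm (poly (p n) w - 1 / (w - b)) \<le> 1 / (2 * ?C)" using n[OF z(1)] z(2) by (simp add: dist_norm)
    ultimately have "norm (q w) \<le> ?C * (1 / (2 * ?C))" using C by (simp only: norm_mult) (intro mult_mono; simp)
    also have "\<dots> = 1 / 2" using C by (simp only: times_divide_eq_right mult_1_right) (simp add: divide_eq_eq)
    finally show "norm (q w) \<le> 1 / 2" .
  qed
  then show False by (simp add: q_def)
qed

text \<open>The point is holomorphy of \<psi> inside \<open>L\<close>. By invariance of domain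
  \<psi> maps the interior of \<open>L\<close> onto an open set, which therefore lies in the
  interior of \<open>K\<close>; there \<phi> is injective and holomorphic, so its inverse is
  holomorphic.\<close>

lemma A_algebra_comp_inverse:
  assumes \<phi>: "\<phi> \<in> A_algebra K" and hom: "homeomorphism K L \<phi> \<psi>" and f: "f \<in> A_algebra K"
  shows "(\<lambda>w. f (\<psi> w)) \<in> A_algebra L"
proof -
  have hf: "continuous_on K f" "f holomorphic_on interior K" using f by (auto simp: A_algebra_def)
  have h\<phi>: "\<phi> holomorphic_on interior K" using \<phi> by (simp add: A_algebra_def)
  have \<psi>: "continuous_on L \<psi>" "\<psi> ` L = K" "\<And>w. w \<in> L \<Longrightarrow> \<phi> (\<psi> w) = w" "\<And>z. z \<in> K \<Longrightarrow> \<psi> (\<phi> z) = z"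
    using hom by (auto simp: homeomorphism_def)
  let ?S = "\<psi> ` interior L"
  have inj: "inj_on \<psi> (interior L)" by (rule inj_on_inverseI[where g = \<phi>]) (use \<psi>(3) interior_subset in blast)
  have op: "open ?S"
    by (rule invariance_of_domain[OF continuous_on_subset[OF \<psi>(1) interior_subset] open_interior inj])
  have "?S \<subseteq> K" using \<psi>(2) interior_subset by blast
  then have S: "?S \<subseteq> interior K" using op by (simp add: interior_maximal)
  have im: "\<phi> ` ?S = interior L"
    unfolding image_image using \<psi>(3) interior_subset by (force simp: image_iff)
  have "inj_on \<phi> ?S"
    by (rule inj_on_inverseI[where g = \<psi>]) (use \<psi>(4) \<open>?S \<subseteq> K\<close> in blast)
  then obtain k where k: "k holomorphic_on \<phi> ` ?S" "\<And>z. z \<in> ?S \<Longrightarrow> k (\<phi> z) = z"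
    using holomorphic_has_inverse[OF holomorphic_on_subset[OF h\<phi> S] op] by metis
  have "\<psi> holomorphic_on interior L"
  proof (rule holomorphic_transform)
    show "k holomorphic_on interior L" using k(1) unfolding im .
    fix w assume w: "w \<in> interior L"
    then have "\<phi> (\<psi> w) = w" using \<psi>(3) interior_subset by blast
    then show "k w = \<psi> w" using k(2)[of "\<psi> w"] w by simp
  qed
  then have "(\<lambda>w. f (\<psi> w)) holomorphic_on interior L"
    using holomorphic_on_compose_gen[of \<psi> "interior L" f "interior K"] hf(2) S by (auto simp: o_def)
  moreover have "continuous_on L (\<lambda>w. f (\<psi> w))"
    by (rule continuous_on_compose2[OF hf(1) \<psi>(1)]) (simp add: \<psi>(2))
  ultimately show ?thesis by (simp add: A_algebra_def)
qed

theorem theorem1p3: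
  fixes K :: "complex set" and \<phi> :: "complex \<Rightarrow> complex"
  assumes "compact K" and "\<phi> \<in> A_algebra K"
  shows "is_generator K \<phi> \<longleftrightarrow>
           (\<exists>\<psi>. homeomorphism K (\<phi> ` K) \<phi> \<psi>) \<and> connected (- K)"
proof -
  note K = assms(1) and \<phi> = assms(2)
  have c: "continuous_on K \<phi>" using \<phi> by (simp add: A_algebra_def)
  have L: "compact (\<phi> ` K)" using c K by (rule compact_continuous_image)
  \<comment> \<open>Both directions work with the complement of \<phi>(K); this transfers
    connectedness between it and the complement of \<open>K\<close>.\<close>
  have conn: "connected (- K) \<longleftrightarrow> connected (- \<phi> ` K)" if "homeomorphism K (\<phi> ` K) \<phi> \<psi>" for \<psi>
    using connected_complement_homeomorphic[OF K L] that unfolding homeomorphic_def by blast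
  show ?thesis
  proof
    assume gen: "is_generator K \<phi>"
    then obtain \<psi> where \<psi>: "homeomorphism K (\<phi> ` K) \<phi> \<psi>"
      using homeomorphism_compact[OF K c refl generator_inj_on] by blast
    then show "(\<exists>\<psi>. homeomorphism K (\<phi> ` K) \<phi> \<psi>) \<and> connected (- K)"
      using conn[OF \<psi>] generator_connected_complement_image[OF K \<phi> gen] by blast
  next
    assume "(\<exists>\<psi>. homeomorphism K (\<phi> ` K) \<phi> \<psi>) \<and> connected (- K)"
    then obtain \<psi> where \<psi>: "homeomorphism K (\<phi> ` K) \<phi> \<psi>" and "connected (- \<phi> ` K)"
      using conn by blast
    have "A_algebra K \<subseteq> generated_closed_subalgebra K \<phi>"
    proof
      fix f assume f: "f \<in> A_algebra K"
      \<comment> \<open>Polynomials close to f \<circ> \<psi> on \<phi>(K) become, after composition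
        with \<phi>, polynomials in \<phi> close to \<open>f\<close> on \<open>K\<close>.\<close>
      have "(\<lambda>w. f (\<psi> w)) \<in> polynomially_approximable (\<phi> ` K)"
        by (rule Mergelyan[OF L \<open>connected (- \<phi> ` K)\<close> A_algebra_comp_inverse[OF \<phi> \<psi> f]])
      then have "\<exists>p. \<forall>w\<in>\<phi> ` K. norm (f (\<psi> w) - poly p w) < 1 / real (Suc n)" for n
        by (simp add: polynomially_approximable_def)
      then obtain p where p: "\<And>n w. w \<in> \<phi> ` K \<Longrightarrow> norm (f (\<psi> w) - poly (p n) w) < 1 / real (Suc n)"
        by metis
      have p': "dist (poly (p n) (\<phi> z)) (f z) < 1 / real (Suc n)" if "z \<in> K" for n z
        using p[of "\<phi> z" n] homeomorphism_apply1[OF \<psi> that] that by (simp add: dist_norm norm_minus_commute)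
      have "uniform_limit K (\<lambda>n z. poly (p n) (\<phi> z)) f sequentially"
      proof (rule uniform_limitI)
        fix e :: real assume "e > 0"
        then obtain N where N: "1 / real (Suc N) < e" using nat_approx_posE by blast
        have "dist (poly (p n) (\<phi> z)) (f z) < e" if "n \<ge> N" "z \<in> K" for n z
        proof -
          have "1 / real (Suc n) \<le> 1 / real (Suc N)" using that(1) by (intro divide_left_mono) auto
          then show ?thesis using p'[OF that(2), of n] N by linarith
        qed
        then show "\<forall>\<^sub>F n in sequentially. \<forall>z\<in>K. dist (poly (p n) (\<phi> z)) (f z) < e"
          by (intro eventually_sequentiallyI[of N]) blast
      qed
      then show "f \<in> generated_closed_subalgebra K \<phi>" by (auto simp: generated_closed_subalgebra_def)
    qed
    then show "is_generator K \<phi>"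
      using generated_closed_subalgebra_subset_A_algebra[OF \<phi>] by (auto simp: is_generator_def)
  qed
qed

end
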